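(* For every $\epsilon>0$, the Tutte polynomial along the curve $H_2$ cannot be computed in time $(2-\epsilon)^{\mathrm{ctw}(G)}n^{O(1)}$ on $n$-vertex graphs $G$ (given with a cut decomposition of width $\mathrm{ctw}(G)$), unless the Strong Exponential Time Hypothesis fails.
   Context: For $G=(V,E)$ (parallel edges allowed) and $A\subseteq E$, $k(A)$ is the number of components of $(V,A)$; $T(G;x,y)=\sum_{A\subseteq E}(x-1)^{k(A)-k(E)}(y-1)^{k(A)+|A|-|V|}$. $H_\alpha=\{(x,y):(x-1)(y-1)=\alpha\}$. Computing the Tutte polynomial along $H_\alpha$ means computing the coefficients of the univariate polynomial $T_\alpha(G;t)=T(G;\alpha/t+1,t+1)$. The cutwidth $\mathrm{ctw}(G)$ is the minimum over vertex orderings $v_1,\dots,v_n$ of the maximum over $i$ of the number of edges $v_jv_l$ with $j\le i<l$. *)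

theory Defs
  imports
    Complex_Main
    "HOL-Library.Log_Nat"
    "HOL-Computational_Algebra.Formal_Laurent_Series"
    "HOL-Combinatorics.Multiset_Permutations"
begin

record ('v, 'e) mgraph =
  verts :: "'v set"
  edges :: "'e set"
  ends :: "'e \<Rightarrow> 'v set"

definition connected_in :: "('v, 'e) mgraph \<Rightarrow> 'e set \<Rightarrow> ('v \<times> 'v) set" where
  "connected_in G A =
     {(u, v). u \<in> verts G \<and> v \<in> verts G \<and> (u, v) \<in> {(a, b). \<exists>e\<in>A. ends G e = {a, b}}\<^sup>*}"

definition num_components :: "('v, 'e) mgraph \<Rightarrow> 'e set \<Rightarrow> nat" where
  "num_components G A = card (verts G // connected_in G A)"

text \<open>The truncated subtractions are exact on finite graphs: for \<open>A \<subseteq> E\<close> one has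
  \<open>k(E) \<le> k(A)\<close> and \<open>|V| \<le> k(A) + |A|\<close>.\<close>

definition tutte :: "('v, 'e) mgraph \<Rightarrow> 'a::comm_ring_1 \<Rightarrow> 'a \<Rightarrow> 'a" where
  "tutte G x y =
     (\<Sum>A\<in>Pow (edges G).
        (x - 1) ^ (num_components G A - num_components G (edges G)) *
        (y - 1) ^ (num_components G A + card A - card (verts G)))"

text \<open>The restriction to the curve \<open>(x - 1) (y - 1) = \<alpha>\<close>, parametrised by
  \<open>x = \<alpha>/t + 1\<close>, \<open>y = t + 1\<close>. In general this is a Laurent polynomial in \<open>t\<close>: its exponents lie
  between \<open>-|V|\<close> and \<open>|E|\<close>.\<close>

definition tutte_curve :: "real \<Rightarrow> ('v, 'e) mgraph \<Rightarrow> real fls" where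
  "tutte_curve \<alpha> G = tutte G (fls_const \<alpha> / fls_X + 1) (fls_X + 1)"

definition cut_edges :: "('v, 'e) mgraph \<Rightarrow> 'v list \<Rightarrow> nat \<Rightarrow> 'e set" where
  "cut_edges G vs i =
     {e \<in> edges G. \<exists>u\<in>set (take i vs). \<exists>v\<in>set (drop i vs). ends G e = {u, v}}"

definition order_width :: "('v, 'e) mgraph \<Rightarrow> 'v list \<Rightarrow> nat" where
  "order_width G vs = Max ((\<lambda>i. card (cut_edges G vs i)) ` {..length vs})"

definition cutwidth :: "('v, 'e) mgraph \<Rightarrow> nat" where
  "cutwidth G = Min (order_width G ` permutations_of_set (verts G))"

text \<open>Structured programs for a random access machine with logarithmic cost: finitely many
  unbounded arrays of natural numbers (those named in the program) with indirect addressing.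
  A scalar variable is an array of which only cell 0 is used. Subtraction is truncated and division by zero yields zero. Every intermediate
  result, address and value read or written is charged its bit length.\<close>

type_synonym memory = "nat \<Rightarrow> nat \<Rightarrow> nat"

datatype aexp =
    N nat
  | Cell nat aexp
  | Add aexp aexp
  | Sub aexp aexp
  | Mul aexp aexp
  | Div aexp aexp

datatype com =
    Skip
  | Store nat aexp aexp
  | Seq com com
  | If aexp com com
  | While aexp com

definition bit_len :: "nat \<Rightarrow> nat" where
  "bit_len n = max 1 (floorlog 2 n)"

fun aval :: "aexp \<Rightarrow> memory \<Rightarrow> nat" where
  "aval (N n) s = n"
| "aval (Cell a e) s = s a (aval e s)"
| "aval (Add e f) s = aval e s + aval f s"
| "aval (Sub e f) s = aval e s - aval f s"
| "aval (Mul e f) s = aval e s * aval f s"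
| "aval (Div e f) s = aval e s div aval f s"

fun acost :: "aexp \<Rightarrow> memory \<Rightarrow> nat" where
  "acost (N n) s = bit_len n"
| "acost (Cell a e) s = acost e s + bit_len (aval (Cell a e) s)"
| "acost (Add e f) s = acost e s + acost f s + bit_len (aval (Add e f) s)"
| "acost (Sub e f) s = acost e s + acost f s + bit_len (aval (Sub e f) s)"
| "acost (Mul e f) s = acost e s + acost f s + bit_len (aval (Mul e f) s)"
| "acost (Div e f) s = acost e s + acost f s + bit_len (aval (Div e f) s)"

text \<open>\<open>exec c s t s'\<close>: started in memory \<open>s\<close>, the program \<open>c\<close> halts after time \<open>t\<close> in memory \<open>s'\<close>.\<close>

inductive exec :: "com \<Rightarrow> memory \<Rightarrow> nat \<Rightarrow> memory \<Rightarrow> bool" where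
  Skip: "exec Skip s 1 s"
| Store: "exec (Store a i e) s (1 + acost i s + acost e s)
            (s(a := (s a)(aval i s := aval e s)))"
| Seq: "\<lbrakk>exec c s t s'; exec d s' t' s''\<rbrakk> \<Longrightarrow> exec (Seq c d) s (t + t') s''"
| IfTrue: "\<lbrakk>aval b s \<noteq> 0; exec c s t s'\<rbrakk> \<Longrightarrow> exec (If b c d) s (1 + acost b s + t) s'"
| IfFalse: "\<lbrakk>aval b s = 0; exec d s t s'\<rbrakk> \<Longrightarrow> exec (If b c d) s (1 + acost b s + t) s'"
| WhileFalse: "aval b s = 0 \<Longrightarrow> exec (While b c) s (1 + acost b s) s"
| WhileTrue: "\<lbrakk>aval b s \<noteq> 0; exec c s t s'; exec (While b c) s' t' s''\<rbrakk>
    \<Longrightarrow> exec (While b c) s (1 + acost b s + t + t') s''"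

text \<open>The input word is placed in array 0, all other cells are 0; the output is read from
  array 1.\<close>

definition init_memory :: "nat list \<Rightarrow> memory" where
  "init_memory w = (\<lambda>a i. if a = 0 \<and> i < length w then w ! i else 0)"

definition outputs_within :: "com \<Rightarrow> nat list \<Rightarrow> real \<Rightarrow> ((nat \<Rightarrow> nat) \<Rightarrow> bool) \<Rightarrow> bool" where
  "outputs_within p w T Q \<longleftrightarrow> (\<exists>t s. exec p (init_memory w) t s \<and> real t \<le> T \<and> Q (s 1))"

text \<open>The literal \<open>(v, b)\<close> is satisfied if variable \<open>v\<close> has truth value \<open>b\<close>.\<close>

type_synonym cnf = "(nat \<times> bool) list list"

definition satisfiable :: "cnf \<Rightarrow> bool" where
  "satisfiable F \<longleftrightarrow> (\<exists>\<sigma>. \<forall>C\<in>set F. \<exists>(v, b)\<in>set C. \<sigma> v = b)"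

definition is_kcnf :: "nat \<Rightarrow> nat \<Rightarrow> cnf \<Rightarrow> bool" where
  "is_kcnf k n F \<longleftrightarrow> (\<forall>C\<in>set F. length C \<le> k \<and> (\<forall>(v, b)\<in>set C. v < n))"

definition encode_cnf :: "nat \<Rightarrow> cnf \<Rightarrow> nat list" where
  "encode_cnf n F =
     [n, length F] @ concat (map (\<lambda>C. length C # map (\<lambda>(v, b). 2 * v + of_bool b) C) F)"

definition solves_kSAT_within :: "nat \<Rightarrow> com \<Rightarrow> (nat \<Rightarrow> nat \<Rightarrow> real) \<Rightarrow> bool" where
  "solves_kSAT_within k p T \<longleftrightarrow>
     (\<forall>n F. is_kcnf k n F \<longrightarrow>
        outputs_within p (encode_cnf n F) (T n (length F)) (\<lambda>out. out 0 \<noteq> 0 \<longleftrightarrow> satisfiable F))"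

text \<open>For every \<open>\<delta> > 0\<close> there is a \<open>k\<close> such that \<open>k\<close>-SAT with \<open>n\<close> variables and \<open>m\<close> clauses has no
  algorithm running in time \<open>(2 - \<delta>)\<^sup>n (n + m)\<^sup>O\<^sup>(\<^sup>1\<^sup>)\<close>. The summand 1 accounts for
  the empty formula.\<close>

definition SETH :: bool where
  "SETH \<longleftrightarrow>
     (\<forall>\<delta>>0. \<exists>k. \<not> (\<exists>p C d. solves_kSAT_within k p
        (\<lambda>n m. C * (2 - \<delta>) ^ n * real (1 + n + m) ^ d)))"

text \<open>An instance consists of the number \<open>n\<close> of vertices, the list of edges (repetitions are
  parallel edges), and a vertex ordering of optimal width. Loops are excluded: they cross
  no cut, so their number is bounded neither by the number of vertices nor by the cutwidth.\<close>

definition graph_of :: "nat \<Rightarrow> (nat \<times> nat) list \<Rightarrow> (nat, nat) mgraph" where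
  "graph_of n es =
     \<lparr>verts = {..<n}, edges = {..<length es}, ends = (\<lambda>i. {fst (es ! i), snd (es ! i)})\<rparr>"

definition is_instance :: "nat \<Rightarrow> (nat \<times> nat) list \<Rightarrow> nat list \<Rightarrow> bool" where
  "is_instance n es vs \<longleftrightarrow>
     0 < n \<and> (\<forall>(u, v)\<in>set es. u < n \<and> v < n \<and> u \<noteq> v) \<and>
     vs \<in> permutations_of_set {..<n} \<and>
     order_width (graph_of n es) vs = cutwidth (graph_of n es)"

definition encode_instance :: "nat \<Rightarrow> (nat \<times> nat) list \<Rightarrow> nat list \<Rightarrow> nat list" where
  "encode_instance n es vs = [n, length es] @ concat (map (\<lambda>(u, v). [u, v]) es) @ vs"

text \<open>Output cell \<open>j\<close> holds the coefficient of \<open>t\<close> to the power \<open>j - n\<close>; the range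
  \<open>0 \<le> j \<le> n + |E|\<close> covers all nonzero coefficients. For \<open>\<alpha> \<in> \<nat>\<close> all coefficients are natural
  numbers.\<close>

definition computes_tutte_curve_within :: "nat \<Rightarrow> com \<Rightarrow> (nat \<Rightarrow> nat \<Rightarrow> real) \<Rightarrow> bool" where
  "computes_tutte_curve_within \<alpha> p T \<longleftrightarrow>
     (\<forall>n es vs. is_instance n es vs \<longrightarrow>
        outputs_within p (encode_instance n es vs) (T n (cutwidth (graph_of n es)))
          (\<lambda>out. \<forall>j \<le> n + length es.
             real (out j) = fls_nth (tutte_curve (real \<alpha>) (graph_of n es)) (int j - int n)))"

end

theory Submission
  imports Defs
begin

text \<open>Along \<open>H\<^sub>2\<close> the Tutte polynomial is the partition function of the Ising model, a sum of
  \<open>(t + 1)\<close>-powers over all 2-colourings, with the number of monochromatic edges as exponent.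
  A CNF formula is laid out as one path per variable, along which a proper colouring alternates,
  and one triangle per literal occurrence, which always has a monochromatic edge and has exactly
  one iff it is not constant. Hence the least conceivable number of monochromatic edges is
  attained iff the formula is satisfiable. With \<open>t = q - 1\<close> for the odd number \<open>q = 3\<^sup>|\<^sup>V\<^sup>|\<close>, which
  exceeds the number of colourings, this is a divisibility question about a single integer.
  Only one edge per variable crosses any cut of the layout, up to an additive constant; a pair of
  vertices joined by as many parallel edges as this bound makes the layout optimal.\<close>

section \<open>The Tutte polynomial on the Ising curve\<close>

text \<open>The base 2 survives only if a variable costs one unit of width and a clause costs none.
  So the literals of a clause are read one after the other, and one further colour, a flag, tells
  whether a true one has occurred. The triangle joins the old flag, the literal and the negated new
  flag. It is constant exactly when the flag is raised without reason (old flag and literal false,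
  new flag true) or in the complementary case (both true, new flag false). Exchanging the two
  colours changes no count, so a colour has no absolute meaning. An extra variable with index
  \<open>n\<close> serves as the constant true, and a literal is true when its vertex has the colour
  of that constant. This makes \<open>n + 1\<close> columns; with at most four further edges of one
  block the width is \<open>n + 5\<close>. The base 3 is the least odd number above 2, which gives
  an odd q exceeding the 2^|V| colourings. As q has only linearly many bits in |V|, evaluating at q
  - 1 takes polynomial time even at logarithmic cost.\<close>

definition monochromatic :: "('v, 'e) mgraph \<Rightarrow> 'v set \<Rightarrow> 'e set" where
  "monochromatic G X = {e \<in> edges G. ends G e \<subseteq> X \<or> ends G e \<inter> X = {}}"

definition fin_graph :: "('v, 'e) mgraph \<Rightarrow> bool" where
  "fin_graph G \<longleftrightarrow> finite (verts G) \<and> finite (edges G) \<and>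
     (\<forall>e\<in>edges G. \<exists>a\<in>verts G. \<exists>b\<in>verts G. ends G e = {a, b})"

definition colourings :: "('v, 'e) mgraph \<Rightarrow> 'e set \<Rightarrow> 'v set set" where
  "colourings G A = {X \<in> Pow (verts G). A \<subseteq> monochromatic G X}"

section \<open>Counting components through 2-colourings\<close>

lemma equiv_connected_in: "equiv (verts G) (connected_in G A)"
proof (rule equivI)
  have "sym {(a, b). \<exists>e\<in>A. ends G e = {a, b}}"
    by (auto simp: sym_def insert_commute)
  then have "sym ({(a, b). \<exists>e\<in>A. ends G e = {a, b}}\<^sup>*)"
    by (rule sym_rtrancl)
  then show "sym (connected_in G A)"
    by (auto simp: connected_in_def sym_def)
qed (auto simp: connected_in_def refl_on_def trans_def)

lemma colouring_connected:
  assumes "X \<in> colourings G A" and "(u, v) \<in> connected_in G A"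
  shows "u \<in> X \<longleftrightarrow> v \<in> X"
proof -
  have "(u, v) \<in> {(a, b). \<exists>e\<in>A. ends G e = {a, b}}\<^sup>*"
    using assms(2) by (simp add: connected_in_def)
  then show ?thesis
  proof (induction rule: rtrancl_induct)
    case (step b c)
    then obtain e where "e \<in> A" "ends G e = {b, c}" by auto
    then have "b \<in> X \<longleftrightarrow> c \<in> X"
      using assms(1) unfolding colourings_def monochromatic_def by fastforce
    with step show ?case by simp
  qed simp
qed

text \<open>A colour class under which all edges of \<open>A\<close> are monochromatic splits no
  component of (V, A). It is therefore a union of components, determined by which of them it
  contains.\<close>

lemma card_colourings:
  assumes G: "fin_graph G" and A: "A \<subseteq> edges G"
  shows "card (colourings G A) = 2 ^ num_components G A"
proof -
  let ?R = "connected_in G A" and ?V = "verts G"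
  note eq = equiv_connected_in[of G A]
  have sub: "c \<subseteq> ?V" if "c \<in> ?V // ?R" for c
    using that eq by (auto simp: quotient_def connected_in_def)
  have "bij_betw Union (Pow (?V // ?R)) (colourings G A)"
  proof (rule bij_betw_byWitness[where f' = "\<lambda>X. {c \<in> ?V // ?R. c \<subseteq> X}"])
    show "\<forall>C\<in>Pow (?V // ?R). {c \<in> ?V // ?R. c \<subseteq> \<Union> C} = C"
    proof (intro ballI equalityI subsetI)
      fix C c assume C: "C \<in> Pow (?V // ?R)" and "c \<in> {c \<in> ?V // ?R. c \<subseteq> \<Union> C}"
      then have c: "c \<in> ?V // ?R" "c \<subseteq> \<Union> C" by auto
      then obtain x where "x \<in> c" using in_quotient_imp_non_empty[OF eq] by blast
      then obtain c' where "c' \<in> C" "x \<in> c'" using c by auto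
      then have "c = c'" using quotient_disj[OF eq c(1), of c'] C \<open>x \<in> c\<close> by blast
      then show "c \<in> C" using \<open>c' \<in> C\<close> by simp
    qed auto
    show "\<forall>X\<in>colourings G A. \<Union> {c \<in> ?V // ?R. c \<subseteq> X} = X"
    proof (intro ballI equalityI subsetI)
      fix X x assume X: "X \<in> colourings G A" and x: "x \<in> X"
      then have xV: "x \<in> ?V" by (auto simp: colourings_def)
      have "?R `` {x} \<subseteq> X" using colouring_connected[OF X] x by auto
      moreover have "?R `` {x} \<in> ?V // ?R" using xV by (rule quotientI)
      moreover have "x \<in> ?R `` {x}" using equiv_class_self[OF eq xV] .
      ultimately show "x \<in> \<Union> {c \<in> ?V // ?R. c \<subseteq> X}" by blast
    qed auto
    show "Union ` Pow (?V // ?R) \<subseteq> colourings G A"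
    proof
      fix X assume "X \<in> Union ` Pow (?V // ?R)"
      then obtain C where C: "C \<subseteq> ?V // ?R" "X = \<Union> C" by auto
      have closed: "v \<in> X" if "(u, v) \<in> ?R" "u \<in> X" for u v
        using that C in_quotient_imp_closed[OF eq] by blast
      have "e \<in> monochromatic G X" if e: "e \<in> A" for e
      proof -
        obtain a b where ab: "a \<in> ?V" "b \<in> ?V" "ends G e = {a, b}"
          using G A e by (meson fin_graph_def subsetD)
        then have "(a, b) \<in> ?R" "(b, a) \<in> ?R"
          using e by (auto simp: connected_in_def insert_commute intro!: r_into_rtrancl)
        then have "a \<in> X \<longleftrightarrow> b \<in> X" using closed by blast
        then show ?thesis using ab A e by (auto simp: monochromatic_def)
      qed
      moreover have "X \<subseteq> ?V" using C sub by blast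
      ultimately show "X \<in> colourings G A" by (auto simp: colourings_def)
    qed
    show "(\<lambda>X. {c \<in> ?V // ?R. c \<subseteq> X}) ` colourings G A \<subseteq> Pow (?V // ?R)" by auto
  qed
  then have "card (colourings G A) = card (Pow (?V // ?R))"
    by (simp add: bij_betw_same_card)
  also have "\<dots> = 2 ^ card (?V // ?R)"
    using G eq by (intro card_Pow finite_quotient) (auto simp: fin_graph_def equiv_def)
  finally show ?thesis by (simp add: num_components_def)
qed

lemma finite_colourings: "fin_graph G \<Longrightarrow> finite (colourings G A)"
  by (auto simp: colourings_def fin_graph_def)

text \<open>More edges admit fewer colourings; the exponents of 2 are then compared. No path has to
  be examined.\<close>

lemma num_components_antimono:
  assumes "fin_graph G" and "A \<subseteq> B" and "B \<subseteq> edges G"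
  shows "num_components G B \<le> num_components G A"
proof -
  have "card (colourings G B) \<le> card (colourings G A)"
    using assms by (intro card_mono finite_colourings) (auto simp: colourings_def)
  then show ?thesis using assms by (simp add: card_colourings)
qed

lemma num_components_le:
  assumes "fin_graph G" and "A \<subseteq> edges G"
  shows "num_components G A \<le> card (verts G)"
proof -
  have "card (colourings G A) \<le> card (Pow (verts G))"
    using assms by (intro card_mono) (auto simp: colourings_def fin_graph_def)
  then show ?thesis using assms by (simp add: card_colourings card_Pow fin_graph_def)
qed

text \<open>The symmetric difference with a fixed colouring that separates the ends of \<open>e\<close> maps the
  colourings not constant on \<open>e\<close> injectively to those constant on \<open>e\<close>.\<close>

lemma card_colourings_insert:
  assumes G: "fin_graph G" and e: "e \<in> edges G"
  shows "card (colourings G A) \<le> 2 * card (colourings G (insert e A))"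
proof (cases "colourings G A \<subseteq> colourings G (insert e A)")
  case True
  then show ?thesis using card_mono[OF finite_colourings[OF G] True] by simp
next
  case False
  let ?M = "colourings G (insert e A)"
  obtain a b where ab: "ends G e = {a, b}"
    using G e by (meson fin_graph_def)
  obtain Y where Y: "Y \<in> colourings G A" "Y \<notin> ?M" using False by auto
  have ab_iff: "X \<in> ?M \<longleftrightarrow> X \<in> colourings G A \<and> (a \<in> X \<longleftrightarrow> b \<in> X)" for X
    using ab e by (auto simp: colourings_def monochromatic_def)
  let ?f = "\<lambda>X. (X - Y) \<union> (Y - X)"
  have "inj_on ?f (colourings G A - ?M)"
    by (rule inj_on_inverseI[where g = ?f]) auto
  moreover have "?f ` (colourings G A - ?M) \<subseteq> ?M"
  proof
    fix Z assume "Z \<in> ?f ` (colourings G A - ?M)"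
    then obtain X where X: "X \<in> colourings G A" "X \<notin> ?M" "Z = ?f X" by auto
    have "c \<in> monochromatic G Z" if "c \<in> A" for c
    proof -
      have "c \<in> monochromatic G X" "c \<in> monochromatic G Y"
        using X Y that by (auto simp: colourings_def)
      then show ?thesis using X(3) by (auto simp: monochromatic_def)
    qed
    then have "Z \<in> colourings G A" using X Y by (auto simp: colourings_def)
    moreover have "a \<in> Z \<longleftrightarrow> b \<in> Z" using X Y ab_iff by auto
    ultimately show "Z \<in> ?M" using ab_iff by simp
  qed
  ultimately have "card (colourings G A - ?M) \<le> card ?M"
    using finite_colourings[OF G] by (rule card_inj_on_le)
  moreover have "card (colourings G A) = card ?M + card (colourings G A - ?M)"
  proof -
    have "?M \<subseteq> colourings G A" by (auto simp: colourings_def)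
    then show ?thesis
      using card_Diff_subset[of ?M "colourings G A"] card_mono[of "colourings G A" ?M]
        finite_colourings[OF G] by simp
  qed
  ultimately show ?thesis by simp
qed

text \<open>Without edges there are 2^|V| colourings, and each added edge at worst halves their
  number. Together with antitonicity this makes the truncated subtractions in the Tutte polynomial
  exact.\<close>

lemma card_verts_le:
  assumes G: "fin_graph G" and A: "A \<subseteq> edges G"
  shows "card (verts G) \<le> num_components G A + card A"
proof -
  have "finite A" using G A by (auto simp: fin_graph_def intro: finite_subset)
  then have "2 ^ card (verts G) \<le> card (colourings G A) * 2 ^ card A" using A
  proof (induction A rule: finite_induct)
    case empty
    have "colourings G {} = Pow (verts G)" by (auto simp: colourings_def)
    then show ?case using G by (simp add: card_Pow fin_graph_def)
  next
    case (insert e A)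
    then have "2 ^ card (verts G) \<le> card (colourings G A) * 2 ^ card A" by simp
    also have "\<dots> \<le> (2 * card (colourings G (insert e A))) * 2 ^ card A"
      using card_colourings_insert[OF G, of e A] insert by (intro mult_right_mono) auto
    finally show ?case using insert by (simp add: mult_ac)
  qed
  then have "(2::nat) ^ card (verts G) \<le> 2 ^ (num_components G A + card A)"
    using G A by (simp add: card_colourings power_add)
  then show ?thesis by simp
qed

section \<open>From the sum over edge sets to the Ising sum\<close>

text \<open>Both sides count the pairs (A, X) in which every edge of A is monochromatic under X,
  with weight x^|A|. A fixed A has 2^k(A) partners X; a fixed X gives the binomial sum over all
  subsets of its monochromatic edges. This is the random-cluster expansion for two states.\<close>

lemma sum_components_eq_ising:
  fixes x :: nat
  assumes G: "fin_graph G"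
  shows "(\<Sum>A\<in>Pow (edges G). 2 ^ num_components G A * x ^ card A) =
         (\<Sum>X\<in>Pow (verts G). (x + 1) ^ card (monochromatic G X))"
proof -
  have fin: "finite (Pow (verts G))" "finite (Pow (edges G))" using G by (auto simp: fin_graph_def)
  have "(\<Sum>A\<in>Pow (edges G). 2 ^ num_components G A * x ^ card A) =
        (\<Sum>A\<in>Pow (edges G). \<Sum>X | X \<in> Pow (verts G) \<and> A \<subseteq> monochromatic G X. x ^ card A)"
    using G by (intro sum.cong) (simp_all add: card_colourings[symmetric] colourings_def)
  also have "\<dots> = (\<Sum>X\<in>Pow (verts G). \<Sum>A | A \<in> Pow (edges G) \<and> A \<subseteq> monochromatic G X. x ^ card A)"
    by (rule sum.swap_restrict[OF fin(2,1)])
  also have "\<dots> = (\<Sum>X\<in>Pow (verts G). (x + 1) ^ card (monochromatic G X))"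
  proof (rule sum.cong)
    fix X
    have sub: "monochromatic G X \<subseteq> edges G" by (auto simp: monochromatic_def)
    then have "{A. A \<in> Pow (edges G) \<and> A \<subseteq> monochromatic G X} = Pow (monochromatic G X)" by auto
    moreover have "finite (monochromatic G X)"
      using sub G by (auto simp: fin_graph_def intro: finite_subset)
    then have "(\<Sum>A\<in>Pow (monochromatic G X). x ^ card A) = (x + 1) ^ card (monochromatic G X)"
      using prod_add[of "monochromatic G X" "\<lambda>_. x" "\<lambda>_. 1"] by simp
    ultimately show "(\<Sum>A | A \<in> Pow (edges G) \<and> A \<subseteq> monochromatic G X. x ^ card A) =
      (x + 1) ^ card (monochromatic G X)" by simp
  qed simp
  finally show ?thesis .
qed

section \<open>Coefficients along the curve\<close>

lemma div_X_power:
  fixes c :: "'a::field"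
  shows "(fls_const c / fls_X) ^ a * fls_X ^ b = fls_const (c ^ a) * fls_X_intpow (int b - int a)"
proof -
  have "(fls_const c / fls_X) ^ a = fls_const (c ^ a) * fls_X_intpow (- int a)"
    unfolding power_divide fls_const_power fls_X_power_conv_shift_1
    using fls_divide_X_intpow_conv_times[of "fls_const c ^ a" "int a"] by simp
  moreover have "fls_X_intpow (- int a) * fls_X_intpow (int b) = (fls_X_intpow (- int a + int b) :: 'a fls)"
    by (rule fls_X_intpow_times_fls_X_intpow)
  ultimately show ?thesis by (simp add: fls_X_power_conv_shift_1 mult.assoc)
qed

text \<open>In the exponent of t, (k(A) + |A| - |V|) - (k(A) - k(E)), the term k(A) cancels. So each
  edge set contributes a single monomial, whose degree depends on |A| only.\<close>

lemma fls_nth_tutte_curve: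
  assumes G: "fin_graph G"
  shows "fls_nth (tutte_curve 2 G) (int j - int (card (verts G))) =
     real (\<Sum>A | A \<in> Pow (edges G) \<and> card A + num_components G (edges G) = j.
        2 ^ (num_components G A - num_components G (edges G)))"
proof -
  let ?k = "num_components G" and ?E = "edges G" and ?n = "card (verts G)"
  have fin: "finite (Pow ?E)" using G by (auto simp: fin_graph_def)
  have tm: "(fls_const 2 / fls_X :: real fls) ^ (?k A - ?k ?E) * fls_X ^ (?k A + card A - ?n) =
      fls_const (2 ^ (?k A - ?k ?E)) * fls_X_intpow (int (card A + ?k ?E) - int ?n)"
    if A: "A \<subseteq> ?E" for A
  proof -
    have "?k ?E \<le> ?k A" "?n \<le> ?k A + card A"
      using num_components_antimono[OF G A] card_verts_le[OF G A] by auto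
    then have "int (?k A + card A - ?n) - int (?k A - ?k ?E) = int (card A + ?k ?E) - int ?n" by simp
    then show ?thesis unfolding div_X_power by simp
  qed
  have "tutte_curve 2 G =
     (\<Sum>A\<in>Pow ?E. fls_const (2 ^ (?k A - ?k ?E)) * fls_X_intpow (int (card A + ?k ?E) - int ?n))"
    unfolding tutte_curve_def tutte_def add_diff_cancel_right' by (intro sum.cong refl tm) auto
  then have "fls_nth (tutte_curve 2 G) (int j - int ?n) =
     (\<Sum>A\<in>Pow ?E. fls_nth (fls_const (2 ^ (?k A - ?k ?E)) * fls_X_intpow (int (card A + ?k ?E) - int ?n))
        (int j - int ?n))"
    by (simp only: fls_nth_sum)
  also have "\<dots> = (\<Sum>A\<in>Pow ?E. if card A + ?k ?E = j then 2 ^ (?k A - ?k ?E) else 0)"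
    by (intro sum.cong) auto
  finally show ?thesis using fin by (simp add: sum.If_cases Int_def)
qed

text \<open>The factor \<open>2 ^ num_components G (edges G)\<close> compensates the normalisation of the Tutte
  polynomial.\<close>

lemma sum_tutte_coeffs:
  fixes x :: nat and out :: "nat \<Rightarrow> nat"
  assumes G: "fin_graph G"
    and out: "\<forall>j \<le> card (verts G) + card (edges G).
      real (out j) = fls_nth (tutte_curve 2 G) (int j - int (card (verts G)))"
  shows "2 ^ num_components G (edges G) * (\<Sum>j \<le> card (verts G) + card (edges G). out j * x ^ j) =
     x ^ num_components G (edges G) * (\<Sum>X\<in>Pow (verts G). (x + 1) ^ card (monochromatic G X))"
proof -
  let ?k = "num_components G" and ?E = "edges G" and ?N = "card (verts G) + card (edges G)"
  have fin: "finite (Pow ?E)" using G by (auto simp: fin_graph_def)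
  have le: "card A + ?k ?E \<le> ?N" if "A \<in> Pow ?E" for A
    using that num_components_le[OF G order_refl] G card_mono[of ?E A] by (auto simp: fin_graph_def)
  have out': "out j = (\<Sum>A | A \<in> Pow ?E \<and> card A + ?k ?E = j. 2 ^ (?k A - ?k ?E))" if "j \<le> ?N" for j
    using out[rule_format, OF that] unfolding fls_nth_tutte_curve[OF G] of_nat_eq_iff .
  have "(\<Sum>j \<le> ?N. out j * x ^ j) =
     (\<Sum>j \<le> ?N. \<Sum>A | A \<in> Pow ?E \<and> card A + ?k ?E = j. 2 ^ (?k A - ?k ?E) * x ^ (card A + ?k ?E))"
    by (intro sum.cong) (auto simp: out' sum_distrib_right)
  also have "\<dots> = (\<Sum>A\<in>Pow ?E. 2 ^ (?k A - ?k ?E) * x ^ (card A + ?k ?E))"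
    using fin le by (intro sum.group) auto
  finally have "2 ^ ?k ?E * (\<Sum>j \<le> ?N. out j * x ^ j) =
     (\<Sum>A\<in>Pow ?E. (2 ^ ?k ?E * 2 ^ (?k A - ?k ?E)) * x ^ (card A + ?k ?E))"
    by (simp add: sum_distrib_left mult_ac)
  also have "\<dots> = (\<Sum>A\<in>Pow ?E. x ^ ?k ?E * (2 ^ ?k A * x ^ card A))"
    using num_components_antimono[OF G] by (intro sum.cong) (auto simp: power_add[symmetric] mult_ac)
  finally show ?thesis
    using sum_components_eq_ising[OF G, of x] by (simp add: sum_distrib_left[symmetric] mult.assoc)
qed

text \<open>Every colouring contributes a power of \<open>q\<close>, and the number of colourings attaining the
  minimal exponent is too small to be divisible by \<open>q\<close>.\<close>

lemma minimal_exponent_iff: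
  fixes q :: nat
  assumes fin: "finite \<X>" and small: "card \<X> < q" and min: "\<And>X. X \<in> \<X> \<Longrightarrow> m \<le> f X"
  shows "q ^ (m + 1) dvd (\<Sum>X\<in>\<X>. q ^ f X) \<longleftrightarrow> (\<forall>X\<in>\<X>. f X \<noteq> m)"
proof -
  let ?M = "{X \<in> \<X>. f X = m}"
  have "(\<Sum>X\<in>\<X>. q ^ f X) = (\<Sum>X\<in>?M. q ^ f X) + (\<Sum>X\<in>\<X> - ?M. q ^ f X)"
    using fin by (subst sum.subset_diff[of ?M]) auto
  also have "(\<Sum>X\<in>?M. q ^ f X) = card ?M * q ^ m" by simp
  finally have split: "(\<Sum>X\<in>\<X>. q ^ f X) = card ?M * q ^ m + (\<Sum>X\<in>\<X> - ?M. q ^ f X)" .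
  have "q ^ (m + 1) dvd (\<Sum>X\<in>\<X> - ?M. q ^ f X)"
    using min by (intro dvd_sum le_imp_power_dvd) fastforce
  then have "q ^ (m + 1) dvd (\<Sum>X\<in>\<X>. q ^ f X) \<longleftrightarrow> q ^ (m + 1) dvd card ?M * q ^ m"
    unfolding split by (rule dvd_add_left_iff)
  also have "\<dots> \<longleftrightarrow> q dvd card ?M"
    using small by (cases "q = 0") simp_all
  also have "\<dots> \<longleftrightarrow> card ?M = 0"
    using small card_mono[OF fin, of ?M] by (metis (lifting) dvd_0_right le_less_trans linorder_not_less mem_Collect_eq nat_dvd_not_less neq0_conv subsetI)
  also have "\<dots> \<longleftrightarrow> (\<forall>X\<in>\<X>. f X \<noteq> m)"
    using fin by auto
  finally show ?thesis .
qed

text \<open>The value at q - 1 and the Ising sum differ by the factors 2^k(E) on one side and (q -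
  1)^k(E) on the other. Both are coprime to q, the first because q is odd, so divisibility by powers
  of q carries over.\<close>

lemma tutte_divisibility_iff:
  fixes q :: nat and out :: "nat \<Rightarrow> nat"
  assumes G: "fin_graph G"
    and out: "\<forall>j \<le> card (verts G) + card (edges G).
      real (out j) = fls_nth (tutte_curve 2 G) (int j - int (card (verts G)))"
    and q: "odd q" "2 ^ card (verts G) < q"
    and min: "\<And>X. X \<subseteq> verts G \<Longrightarrow> m \<le> card (monochromatic G X)"
  shows "q ^ (m + 1) dvd (\<Sum>j \<le> card (verts G) + card (edges G). out j * (q - 1) ^ j) \<longleftrightarrow>
     (\<forall>X\<subseteq>verts G. card (monochromatic G X) \<noteq> m)"
proof -
  let ?P = "\<Sum>j \<le> card (verts G) + card (edges G). out j * (q - 1) ^ j"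
  let ?k = "num_components G (edges G)"
  let ?Z = "\<Sum>X\<in>Pow (verts G). q ^ card (monochromatic G X)"
  have q1: "q - 1 + 1 = q" using q by simp
  have eq: "2 ^ ?k * ?P = (q - 1) ^ ?k * ?Z"
    using sum_tutte_coeffs[OF G out, of "q - 1"] unfolding q1 .
  have c2: "coprime (q ^ (m + 1)) (2 ^ ?k)" using q by simp
  have c1: "coprime (q ^ (m + 1)) ((q - 1) ^ ?k)"
    using q coprime_diff_one_right_nat[of q] by (simp add: odd_pos)
  have "q ^ (m + 1) dvd ?P \<longleftrightarrow> q ^ (m + 1) dvd 2 ^ ?k * ?P"
    by (rule coprime_dvd_mult_right_iff[OF c2, symmetric])
  also have "\<dots> \<longleftrightarrow> q ^ (m + 1) dvd ?Z"
    unfolding eq by (rule coprime_dvd_mult_right_iff[OF c1])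
  also have "\<dots> \<longleftrightarrow> (\<forall>X\<in>Pow (verts G). card (monochromatic G X) \<noteq> m)"
    using G q(2) min by (intro minimal_exponent_iff) (auto simp: fin_graph_def card_Pow)
  finally show ?thesis by auto
qed

text \<open>At most 2^|E| edge sets have weight at most 2^|V| each. The bound limits the bit lengths
  met when the polynomial is evaluated.\<close>

lemma tutte_coeff_le:
  fixes out :: "nat \<Rightarrow> nat"
  assumes G: "fin_graph G"
    and out: "real (out j) = fls_nth (tutte_curve 2 G) (int j - int (card (verts G)))"
  shows "out j \<le> 2 ^ (card (verts G) + card (edges G))"
proof -
  let ?k = "num_components G" and ?E = "edges G"
  let ?S = "{A. A \<in> Pow ?E \<and> card A + ?k ?E = j}"
  have fin: "finite (Pow ?E)" using G by (auto simp: fin_graph_def)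
  have "out j = (\<Sum>A\<in>?S. 2 ^ (?k A - ?k ?E))"
    using out unfolding fls_nth_tutte_curve[OF G] of_nat_eq_iff .
  also have "\<dots> \<le> (\<Sum>A\<in>?S. 2 ^ card (verts G))"
  proof (rule sum_mono)
    fix A assume "A \<in> ?S"
    then have "?k A \<le> card (verts G)" using num_components_le[OF G, of A] by simp
    then show "(2::nat) ^ (?k A - ?k ?E) \<le> 2 ^ card (verts G)" by (intro power_increasing) simp_all
  qed
  also have "\<dots> \<le> (\<Sum>A\<in>Pow ?E. 2 ^ card (verts G))"
    using fin by (intro sum_mono2) auto
  also have "\<dots> = 2 ^ (card (verts G) + card ?E)"
    using G by (simp add: card_Pow fin_graph_def power_add)
  finally show ?thesis .
qed

section \<open>The graph of a formula\<close>

text \<open>A block of \<open>2 * n + 4\<close> vertices follows each vertex \<open>a\<close>. Its vertex \<open>a + 1 + c\<close> carries the value of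
  the literal with code \<open>c < 2 * n\<close>, the next two carry the constants false and true, and the last two
  carry \<open>\<not> z\<close> and \<open>z\<close>, where \<open>z\<close> may only be true if the current clause already contains a true literal.
  Vertex \<open>a\<close> carries the previous \<open>z\<close>. The token \<open>Some c\<close> is a literal; \<open>None\<close> separates clauses: it
  demands that the previous \<open>z\<close> is true and resets \<open>z\<close>.\<close>

definition step_edges :: "nat \<Rightarrow> nat \<Rightarrow> nat option \<Rightarrow> (nat \<times> nat) list" where
  "step_edges n a t =
     concat (map (\<lambda>j. [(a + 1 + 2 * j, a + 2 + 2 * j), (a + 2 + 2 * j, a + 2 * n + 5 + 2 * j)]) [0..<n + 1]) @
     [(a + 2 * n + 3, a + 2 * n + 4)] @
     (case t of
        None \<Rightarrow> [(a, a + 2 * n + 1), (a + 2 * n + 2, a + 2 * n + 4)]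
      | Some c \<Rightarrow> [(a, a + 1 + c), (a + 1 + c, a + 2 * n + 3), (a, a + 2 * n + 3)])"

fun steps_edges :: "nat \<Rightarrow> nat \<Rightarrow> nat option list \<Rightarrow> (nat \<times> nat) list" where
  "steps_edges n a [] = []"
| "steps_edges n a (t # ts) = step_edges n a t @ steps_edges n (a + 2 * n + 4) ts"

text \<open>The separator in front of the first clause makes the initial flag at vertex 0 true; each
  later one, including the final one, checks the clause that has just ended.\<close>

definition tokens :: "cnf \<Rightarrow> nat option list" where
  "tokens F = concat (map (\<lambda>C. None # map (\<lambda>(v, b). Some (2 * v + of_bool b)) C) F) @ [None]"

text \<open>The paths of the last token lead into one more block, so \<open>length ts + 1\<close>
  blocks follow vertex 0. The two vertices behind them are joined by the parallel edges, whose
  number is the crossing bound of the blocks.\<close>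

definition ising_edges :: "nat \<Rightarrow> nat option list \<Rightarrow> (nat \<times> nat) list" where
  "ising_edges n ts = steps_edges n 0 ts @
     replicate (n + 5) ((length ts + 1) * (2 * n + 4) + 1, (length ts + 1) * (2 * n + 4) + 2)"

definition ising_order :: "nat \<Rightarrow> nat option list \<Rightarrow> nat" where
  "ising_order n ts = (length ts + 1) * (2 * n + 4) + 3"

fun num_literals :: "nat option list \<Rightarrow> nat" where
  "num_literals [] = 0"
| "num_literals (t # ts) = of_bool (t \<noteq> None) + num_literals ts"

section \<open>Monochromatic edges of the graph\<close>

definition mono_count :: "nat set \<Rightarrow> (nat \<times> nat) list \<Rightarrow> nat" where
  "mono_count X es = length (filter (\<lambda>(u, v). u \<in> X \<longleftrightarrow> v \<in> X) es)"

lemma mono_count_simps [simp]: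
  "mono_count X [] = 0"
  "mono_count X (e # es) = of_bool (fst e \<in> X \<longleftrightarrow> snd e \<in> X) + mono_count X es"
  "mono_count X (es @ fs) = mono_count X es + mono_count X fs"
  by (auto simp: mono_count_def)

lemma mono_count_eq_0_iff: "mono_count X es = 0 \<longleftrightarrow> (\<forall>(u, v)\<in>set es. \<not> (u \<in> X \<longleftrightarrow> v \<in> X))"
  by (auto simp: mono_count_def filter_empty_conv)

lemma card_monochromatic_graph_of:
  "card (monochromatic (graph_of m es) X) = mono_count X es"
proof -
  have "monochromatic (graph_of m es) X =
      {i. i < length es \<and> (case es ! i of (u, v) \<Rightarrow> u \<in> X \<longleftrightarrow> v \<in> X)}"
    by (auto simp: monochromatic_def graph_of_def case_prod_unfold)
  then show ?thesis by (simp add: mono_count_def length_filter_conv_card)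
qed

definition step_ok :: "nat set \<Rightarrow> nat \<Rightarrow> nat \<Rightarrow> nat option \<Rightarrow> bool" where
  "step_ok X n a t \<longleftrightarrow>
     (\<forall>j\<le>n. (a + 1 + 2 * j \<in> X) = (a + 2 + 2 * j \<notin> X) \<and> (a + 2 + 2 * j \<in> X) = (a + 2 * n + 5 + 2 * j \<notin> X)) \<and>
     (a + 2 * n + 3 \<in> X) = (a + 2 * n + 4 \<notin> X) \<and>
     (case t of
        None \<Rightarrow> (a \<in> X) = (a + 2 * n + 1 \<notin> X) \<and> (a + 2 * n + 2 \<in> X) = (a + 2 * n + 4 \<notin> X)
      | Some c \<Rightarrow> \<not> ((a \<in> X) = (a + 1 + c \<in> X) \<and> (a \<in> X) = (a + 2 * n + 3 \<in> X)))"

fun steps_ok :: "nat set \<Rightarrow> nat \<Rightarrow> nat \<Rightarrow> nat option list \<Rightarrow> bool" where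
  "steps_ok X n a [] = True"
| "steps_ok X n a (t # ts) \<longleftrightarrow> step_ok X n a t \<and> steps_ok X n (a + 2 * n + 4) ts"

text \<open>A 2-coloured triangle has three monochromatic edges if it is constant and exactly one
  otherwise. All other edges of a block can be bichromatic, so one per literal is the least possible
  number.\<close>

lemma mono_count_step:
  "of_bool (t \<noteq> None) \<le> mono_count X (step_edges n a t)"
  "mono_count X (step_edges n a t) = of_bool (t \<noteq> None) \<longleftrightarrow> step_ok X n a t"
proof -
  let ?L = "concat (map (\<lambda>j. [(a + 1 + 2 * j, a + 2 + 2 * j), (a + 2 + 2 * j, a + 2 * n + 5 + 2 * j)]) [0..<n + 1])"
  have L: "mono_count X ?L = 0 \<longleftrightarrow>
      (\<forall>j\<le>n. (a + 1 + 2 * j \<in> X) = (a + 2 + 2 * j \<notin> X) \<and> (a + 2 + 2 * j \<in> X) = (a + 2 * n + 5 + 2 * j \<notin> X))"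
    unfolding mono_count_eq_0_iff by (auto simp: less_Suc_eq_le)
  show "of_bool (t \<noteq> None) \<le> mono_count X (step_edges n a t)"
    by (auto simp: step_edges_def split: option.split)
  show "mono_count X (step_edges n a t) = of_bool (t \<noteq> None) \<longleftrightarrow> step_ok X n a t"
    unfolding step_edges_def step_ok_def L[symmetric] by (auto split: option.split)
qed

text \<open>A sum of local lower bounds is attained only if each of them is attained.\<close>

lemma mono_count_steps:
  "num_literals ts \<le> mono_count X (steps_edges n a ts)"
  "mono_count X (steps_edges n a ts) = num_literals ts \<longleftrightarrow> steps_ok X n a ts"
proof (induction ts arbitrary: a)
  case (Cons t ts)
  { case (1 a)
    show ?case using mono_count_step(1)[of t X n a] Cons.IH(1)[of "a + 2 * n + 4"] by simp }
  { case (2 a)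
    show ?case
      using mono_count_step(1)[of t X n a] Cons.IH(1)[of "a + 2 * n + 4"]
      unfolding num_literals.simps steps_edges.simps mono_count_simps steps_ok.simps
        mono_count_step(2)[of X n a t, symmetric] Cons.IH(2)[of "a + 2 * n + 4", symmetric]
      by linarith }
qed auto

section \<open>Colourings as runs over the tokens\<close>

text \<open>\<open>z\<close> records whether the clause read so far contains a true literal.\<close>

fun accepts :: "(nat \<Rightarrow> bool) \<Rightarrow> bool \<Rightarrow> nat option list \<Rightarrow> bool" where
  "accepts lit z [] = True"
| "accepts lit z (None # ts) \<longleftrightarrow> z \<and> accepts lit False ts"
| "accepts lit z (Some c # ts) = accepts lit (z \<or> lit c) ts"

text \<open>A triangle allows the flag to drop when old flag and literal differ. The flag read off a
  colouring may thus be smaller than the disjunction computed by \<open>accepts\<close>, and this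
  lemma closes the gap.\<close>

lemma accepts_mono: "accepts lit z ts \<Longrightarrow> (z \<longrightarrow> z') \<Longrightarrow> accepts lit z' ts"
  by (induction lit z ts arbitrary: z' rule: accepts.induct) auto

lemma accepts_literals:
  "accepts lit z (map (\<lambda>(v, b). Some (2 * v + of_bool b)) C @ ts) =
     accepts lit (z \<or> (\<exists>(v, b)\<in>set C. lit (2 * v + of_bool b))) ts"
  by (induction C arbitrary: z) (simp_all add: case_prod_unfold disj_assoc del: of_bool_eq_iff)

lemma accepts_tokens:
  "accepts lit z (tokens F) \<longleftrightarrow> z \<and> (\<forall>C\<in>set F. \<exists>(v, b)\<in>set C. lit (2 * v + of_bool b))"
proof (induction F arbitrary: z)
  case (Cons C F)
  have "tokens (C # F) = None # map (\<lambda>(v, b). Some (2 * v + of_bool b)) C @ tokens F"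
    by (simp add: tokens_def)
  then show ?case using Cons.IH by (simp only: accepts.simps accepts_literals) simp
qed (simp add: tokens_def)

text \<open>Alternation along the paths reproduces the colours of the first block in every later
  one, so \<open>v\<close> stays the same throughout. All truth values are taken relative to
  \<open>v n\<close>, the colour of the constant true, because complementing a colouring is
  invisible to the edges.\<close>

lemma accepts_if_steps_ok:
  assumes "steps_ok X n a ts" and "\<forall>c. Some c \<in> set ts \<longrightarrow> c < 2 * n"
    and "\<forall>j\<le>n. (a + 1 + 2 * j \<in> X) = (\<not> v j)"
  shows "accepts (\<lambda>c. (if odd c then v (c div 2) else \<not> v (c div 2)) = v n) ((a \<in> X) = v n) ts"
  using assms
proof (induction ts arbitrary: a)
  case (Cons t ts)
  let ?lit = "\<lambda>c. (if odd c then v (c div 2) else \<not> v (c div 2)) = v n" and ?a = "a + 2 * n + 4"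
  have ok: "step_ok X n a t" using Cons.prems by simp
  have neg: "(a + 1 + 2 * j \<in> X) = (\<not> v j)" if "j \<le> n" for j using Cons.prems that by simp
  have pos: "(a + 2 + 2 * j \<in> X) = v j" if "j \<le> n" for j
    using ok neg[OF that] that by (simp add: step_ok_def)
  have nxt: "(a + 2 * n + 5 + 2 * j \<in> X) = (\<not> v j)" if "j \<le> n" for j
    using ok pos[OF that] that unfolding step_ok_def by blast
  have lit: "((a + 1 + c \<in> X) = v n) = ?lit c" if "c < 2 * n" for c
  proof (cases "odd c")
    case True
    then obtain j where "c = 2 * j + 1" by (rule oddE)
    then show ?thesis using that pos[of j] by simp
  next
    case False
    then obtain j where "c = 2 * j" by (auto elim: evenE)
    then show ?thesis using that neg[of j] by simp
  qed
  have IH: "accepts ?lit ((?a \<in> X) = v n) ts"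
    using Cons.prems nxt by (intro Cons.IH) (simp_all add: add_ac)
  show ?case
  proof (cases t)
    case None
    then have "(a \<in> X) = v n" "(?a \<in> X) \<noteq> v n"
      using ok neg[of n] pos[of n] by (auto simp: step_ok_def add_ac)
    then show ?thesis using IH None by simp
  next
    case (Some c)
    then have "c < 2 * n" using Cons.prems by simp
    have "\<not> ((a \<in> X) = (a + 1 + c \<in> X) \<and> (a \<in> X) = (?a \<notin> X))"
      using ok Some by (auto simp: step_ok_def)
    then have "(?a \<in> X) = v n \<longrightarrow> (a \<in> X) = v n \<or> ?lit c"
      using lit[OF \<open>c < 2 * n\<close>] by blast
    then show ?thesis using accepts_mono[OF IH] Some by simp
  qed
qed simp

text \<open>The conditions that a coloured block imposes on the old flag \<open>z\<close> and the
  new flag \<open>z'\<close>. The negation of \<open>z'\<close> occurs since the triangle ends at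
  the vertex carrying the negated flag.\<close>

fun transition :: "(nat \<Rightarrow> bool) \<Rightarrow> nat option \<Rightarrow> bool \<Rightarrow> bool \<Rightarrow> bool" where
  "transition lit None z z' \<longleftrightarrow> z \<and> \<not> z'"
| "transition lit (Some c) z z' \<longleftrightarrow> \<not> (z = lit c \<and> z = (\<not> z'))"

text \<open>The run with \<open>z \<or> lit c\<close> after a literal and false after a separator
  avoids both constant triangles.\<close>

lemma accepts_run:
  "accepts lit z ts \<Longrightarrow> \<exists>f. f 0 = z \<and> (\<forall>i<length ts. transition lit (ts ! i) (f i) (f (Suc i)))"
proof (induction lit z ts rule: accepts.induct)
  case (2 lit z ts)
  then obtain f where "f 0 = False" "\<forall>i<length ts. transition lit (ts ! i) (f i) (f (Suc i))" by auto
  with 2 show ?case by (intro exI[of _ "case_nat z f"]) (auto simp: nth_Cons split: nat.split)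
next
  case (3 lit z c ts)
  then obtain f where "f 0 = (z \<or> lit c)" "\<forall>i<length ts. transition lit (ts ! i) (f i) (f (Suc i))" by auto
  then show ?case by (intro exI[of _ "case_nat z f"]) (auto simp: nth_Cons split: nat.split)
qed auto

text \<open>Offsets below \<open>2 * n + 2\<close> repeat the same literals in every block, with the
  constants as the two literals of variable \<open>n\<close>. The last vertex of block
  \<open>l\<close> is also the vertex preceding block \<open>l + 1\<close>, hence the index
  \<open>Suc l\<close> of the flag.\<close>

definition run_colouring :: "nat \<Rightarrow> (nat \<Rightarrow> bool) \<Rightarrow> (nat \<Rightarrow> bool) \<Rightarrow> nat set" where
  "run_colouring n lit f = {x. if x = 0 then f 0 else
     let l = (x - 1) div (2 * n + 4); c = (x - 1) mod (2 * n + 4) in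
       if c < 2 * n + 2 then lit c else f (Suc l) = (c = 2 * n + 3)}"

lemma in_run_colouring:
  assumes "c < 2 * n + 4"
  shows "l * (2 * n + 4) + Suc c \<in> run_colouring n lit f \<longleftrightarrow>
     (if c < 2 * n + 2 then lit c else f (Suc l) = (c = 2 * n + 3))"
proof -
  have "(l * (2 * n + 4) + c) div (2 * n + 4) = l" "(l * (2 * n + 4) + c) mod (2 * n + 4) = c"
    using assms by auto
  then show ?thesis by (simp add: run_colouring_def Let_def del: mult_Suc_right distrib_left_numeral add_mult_distrib2)
qed

lemma multiple_in_run_colouring:
  "l * (2 * n + 4) \<in> run_colouring n lit f \<longleftrightarrow> f l"
proof (cases l)
  case (Suc k)
  then have l: "l * (2 * n + 4) = k * (2 * n + 4) + Suc (2 * n + 3)" by simp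
  show ?thesis unfolding l using in_run_colouring[of "2 * n + 3" n k lit f] Suc by simp
qed (simp add: run_colouring_def)

lemma steps_ok_run_colouring:
  assumes lit: "\<forall>j\<le>n. lit (2 * j) = (\<not> lit (2 * j + 1))" "lit (2 * n + 1)"
    and "\<forall>i<length ts. transition lit (ts ! i) (f (l + i)) (f (Suc (l + i)))"
    and "\<forall>c. Some c \<in> set ts \<longrightarrow> c < 2 * n"
  shows "steps_ok (run_colouring n lit f) n (l * (2 * n + 4)) ts"
  using assms(3,4)
proof (induction ts arbitrary: l)
  case (Cons t ts)
  let ?X = "run_colouring n lit f" and ?a = "l * (2 * n + 4)"
  have tr: "transition lit t (f l) (f (Suc l))" using Cons.prems(1)[rule_format, of 0] by simp
  note a = multiple_in_run_colouring[of l n lit f]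
  note mem = in_run_colouring[of _ n l lit f]
  note mem' = in_run_colouring[of _ n "Suc l" lit f]
  have "step_ok ?X n ?a t"
    unfolding step_ok_def
  proof (intro conjI allI impI)
    fix j assume j: "j \<le> n"
    have j0: "?a + 1 + 2 * j = ?a + Suc (2 * j)" "?a + 2 + 2 * j = ?a + Suc (2 * j + 1)"
      "?a + 2 * n + 5 + 2 * j = Suc l * (2 * n + 4) + Suc (2 * j)" by simp_all
    show "(?a + 1 + 2 * j \<in> ?X) = (?a + 2 + 2 * j \<notin> ?X)"
      unfolding j0 using mem[of "2 * j"] mem[of "2 * j + 1"] j lit(1) by simp
    show "(?a + 2 + 2 * j \<in> ?X) = (?a + 2 * n + 5 + 2 * j \<notin> ?X)"
      unfolding j0 using mem'[of "2 * j"] mem[of "2 * j + 1"] j lit(1) by simp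
  next
    have e: "?a + 2 * n + 1 = ?a + Suc (2 * n)" "?a + 2 * n + 2 = ?a + Suc (2 * n + 1)"
      "?a + 2 * n + 3 = ?a + Suc (2 * n + 2)" "?a + 2 * n + 4 = ?a + Suc (2 * n + 3)"
      "?a + 1 + c = ?a + Suc c" for c by simp_all
    show "(?a + 2 * n + 3 \<in> ?X) = (?a + 2 * n + 4 \<notin> ?X)"
      unfolding e using mem[of "2 * n + 2"] mem[of "2 * n + 3"] by simp
    show "case t of
        None \<Rightarrow> (?a \<in> ?X) = (?a + 2 * n + 1 \<notin> ?X) \<and> (?a + 2 * n + 2 \<in> ?X) = (?a + 2 * n + 4 \<notin> ?X)
      | Some c \<Rightarrow> \<not> ((?a \<in> ?X) = (?a + 1 + c \<in> ?X) \<and> (?a \<in> ?X) = (?a + 2 * n + 3 \<in> ?X))"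
    proof (cases t)
      case None
      then show ?thesis
        unfolding e using a mem[of "2 * n"] mem[of "2 * n + 1"] mem[of "2 * n + 3"] tr lit by simp
    next
      case (Some c)
      then have "c < 2 * n" using Cons.prems by simp
      then show ?thesis
        unfolding e using a mem[of c] mem[of "2 * n + 2"] tr Some by simp
    qed
  qed
  moreover have "steps_ok ?X n (Suc l * (2 * n + 4)) ts"
  proof (rule Cons.IH)
    show "\<forall>i<length ts. transition lit (ts ! i) (f (Suc l + i)) (f (Suc (Suc l + i)))"
      using Cons.prems(1) by (auto dest: spec[of _ "Suc _"])
  qed (use Cons.prems in auto)
  moreover have "Suc l * (2 * n + 4) = ?a + 2 * n + 4" by simp
  ultimately show ?case by (simp only: steps_ok.simps) 
qed simp

lemma tokens_less:
  assumes "is_kcnf k n F" and "Some c \<in> set (tokens F)"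
  shows "c < 2 * n"
proof -
  obtain C v b where "C \<in> set F" "(v, b) \<in> set C" "c = 2 * v + of_bool b"
    using assms(2) unfolding tokens_def by (auto simp del: UN_insert split: if_splits)
  then show ?thesis using assms(1) by (fastforce simp: is_kcnf_def)
qed

lemma mono_count_replicate:
  "mono_count X (replicate m e) = m * of_bool (fst e \<in> X \<longleftrightarrow> snd e \<in> X)"
  by (induction m) auto

lemma mono_count_ising_ge: "num_literals ts \<le> mono_count X (ising_edges n ts)"
  using mono_count_steps(1)[of ts X n 0] by (simp add: ising_edges_def)

lemma satisfiable_iff_mono_count:
  assumes F: "is_kcnf k n F"
  shows "satisfiable F \<longleftrightarrow> (\<exists>X. mono_count X (ising_edges n (tokens F)) = num_literals (tokens F))"
proof
  let ?ts = "tokens F" 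
  note less = tokens_less[OF F]
  {
    assume "satisfiable F"
    then obtain \<sigma> where \<sigma>: "\<forall>C\<in>set F. \<exists>(v, b)\<in>set C. \<sigma> v = b" by (auto simp: satisfiable_def)
    \<comment> \<open>Index \<open>n\<close>, which no literal of the formula uses, supplies the
      constant true.\<close>
    define v where "v j = (j = n \<or> \<sigma> j)" for j
    define lit where "lit c = (if odd c then v (c div 2) else \<not> v (c div 2))" for c
    have lit_eq: "lit (2 * x + of_bool b) = (\<sigma> x = b)" if "x < n" for x b
      using that by (cases b) (auto simp: lit_def v_def)
    have "accepts lit True ?ts"
      unfolding accepts_tokens
    proof (intro conjI ballI TrueI)
      fix C assume C: "C \<in> set F"
      then obtain x b where xb: "(x, b) \<in> set C" "\<sigma> x = b" using \<sigma> by blast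
      then have "x < n" using F C by (auto simp: is_kcnf_def)
      then show "\<exists>(v, b)\<in>set C. lit (2 * v + of_bool b)" using xb lit_eq by blast
    qed
    then obtain f where "\<forall>i<length ?ts. transition lit (?ts ! i) (f i) (f (Suc i))"
      using accepts_run by blast
    moreover have litn: "\<forall>j\<le>n. lit (2 * j) = (\<not> lit (2 * j + 1))" "lit (2 * n + 1)"
      by (auto simp: lit_def v_def)
    ultimately have "steps_ok (run_colouring n lit f) n (0 * (2 * n + 4)) ?ts"
      using less by (intro steps_ok_run_colouring) auto
    then have "mono_count (run_colouring n lit f) (steps_edges n 0 ?ts) = num_literals ?ts"
      by (simp add: mono_count_steps(2))
    \<comment> \<open>The ends of the parallel edges sit at offsets 0 and 1 of the block after the
      last one. \<open>run_colouring\<close> gives them the colours \<open>lit 0\<close> and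
      \<open>lit 1\<close>, which are opposite, so no parallel edge is monochromatic.\<close>
    moreover have "((length ?ts + 1) * (2 * n + 4) + 1 \<in> run_colouring n lit f) \<noteq>
        ((length ?ts + 1) * (2 * n + 4) + 2 \<in> run_colouring n lit f)"
    proof -
      have "(length ?ts + 1) * (2 * n + 4) + 1 = (length ?ts + 1) * (2 * n + 4) + Suc 0"
        "(length ?ts + 1) * (2 * n + 4) + 2 = (length ?ts + 1) * (2 * n + 4) + Suc 1" by simp_all
      then show ?thesis
        using in_run_colouring[of 0 n "length ?ts + 1" lit f] in_run_colouring[of 1 n "length ?ts + 1" lit f]
          litn(1)[rule_format, of 0] by (simp only: ) simp
    qed
    ultimately show "\<exists>X. mono_count X (ising_edges n ?ts) = num_literals ?ts"
      by (intro exI[of _ "run_colouring n lit f"]) (simp add: ising_edges_def mono_count_replicate)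
  }
  assume "\<exists>X. mono_count X (ising_edges n ?ts) = num_literals ?ts"
  then obtain X where "mono_count X (ising_edges n ?ts) = num_literals ?ts" ..
  then have "steps_ok X n 0 ?ts"
    using mono_count_steps(1)[of ?ts X n 0] by (simp add: ising_edges_def flip: mono_count_steps(2))
  \<comment> \<open>Vertex \<open>1 + 2 * j\<close> of the first block carries the negative literal
    of variable \<open>j\<close>.\<close>
  define v where "v j = (1 + 2 * j \<notin> X)" for j
  have "accepts (\<lambda>c. (if odd c then v (c div 2) else \<not> v (c div 2)) = v n) ((0 \<in> X) = v n) ?ts"
    using \<open>steps_ok X n 0 ?ts\<close> less by (intro accepts_if_steps_ok) (auto simp: v_def)
  then have sat: "\<forall>C\<in>set F. \<exists>(x, b)\<in>set C.
      (if odd (2 * x + of_bool b) then v ((2 * x + of_bool b) div 2)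
       else \<not> v ((2 * x + of_bool b) div 2)) = v n" unfolding accepts_tokens by blast
  show "satisfiable F"
    unfolding satisfiable_def
  proof (intro exI[of _ "\<lambda>x. v x = v n"] ballI)
    fix C assume "C \<in> set F"
    then obtain x b where "(x, b) \<in> set C"
      "(if odd (2 * x + of_bool b) then v ((2 * x + of_bool b) div 2)
       else \<not> v ((2 * x + of_bool b) div 2)) = v n" using sat by blast
    then show "\<exists>(x, b)\<in>set C. (v x = v n) = b" by (intro bexI[of _ "(x, b)"]) (cases b; auto)+
  qed
qed

section \<open>The cutwidth of the graph\<close>

text \<open>Each column of the layout carries a path that moves monotonically through the blocks, so it
  crosses a cut at most once; at most four further edges of a single block do.\<close>

definition crossing :: "nat \<Rightarrow> (nat \<times> nat) list \<Rightarrow> nat" where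
  "crossing i es = length (filter (\<lambda>(u, v). u < i \<and> i \<le> v) es)"

lemma crossing_simps [simp]:
  "crossing i [] = 0"
  "crossing i (e # es) = of_bool (fst e < i \<and> i \<le> snd e) + crossing i es"
  "crossing i (es @ fs) = crossing i es + crossing i fs"
  by (auto simp: crossing_def)

lemma crossing_concat: "crossing i (concat (map f xs)) = (\<Sum>x\<leftarrow>xs. crossing i (f x))"
  by (induction xs) auto

lemma crossing_replicate: "crossing i (replicate m e) = m * of_bool (fst e < i \<and> i \<le> snd e)"
  by (induction m) auto

text \<open>The two path edges of column \<open>j\<close> meet at a vertex and cover one interval
  without overlap. The other edges number at most four (the flag edge and a triangle) and lie within
  the range from \<open>a\<close> to \<open>a + 2 * n + 4\<close>.\<close>

lemma crossing_step:
  assumes "\<forall>c. t = Some c \<longrightarrow> c < 2 * n"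
  shows "crossing i (step_edges n a t) \<le>
    (\<Sum>j\<le>n. of_bool (a + 1 + 2 * j < i \<and> i \<le> a + 2 * n + 5 + 2 * j)) +
    4 * of_bool (a < i \<and> i \<le> a + 2 * n + 4)"
proof -
  let ?f = "\<lambda>j. [(a + 1 + 2 * j, a + 2 + 2 * j), (a + 2 + 2 * j, a + 2 * n + 5 + 2 * j)]"
  have "crossing i (concat (map ?f [0..<n + 1])) = (\<Sum>j\<leftarrow>[0..<n + 1]. crossing i (?f j))"
    by (rule crossing_concat)
  also have "\<dots> = (\<Sum>j\<le>n. crossing i (?f j))"
    by (simp only: sum_list_distinct_conv_sum_set distinct_upt set_upt)
       (simp only: atLeast0LessThan lessThan_Suc_atMost Suc_eq_plus1[symmetric])
  also have "\<dots> = (\<Sum>j\<le>n. of_bool (a + 1 + 2 * j < i \<and> i \<le> a + 2 * n + 5 + 2 * j))"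
    by (intro sum.cong) auto
  finally show ?thesis
    using assms by (auto simp: step_edges_def split: option.split)
qed

text \<open>The interval of a column ends where its continuation in the next block begins, and the
  ranges of consecutive blocks abut. So the contributions join end to end instead of adding
  up.\<close>

lemma crossing_steps:
  assumes "\<forall>c. Some c \<in> set ts \<longrightarrow> c < 2 * n"
  shows "crossing i (steps_edges n a ts) \<le> (\<Sum>j\<le>n. of_bool (a + 1 + 2 * j < i)) + 4 * of_bool (a < i)"
  using assms
proof (induction ts arbitrary: a)
  case (Cons t ts)
  let ?a = "a + 2 * n + 4"
  have "crossing i (steps_edges n a (t # ts)) \<le>
     ((\<Sum>j\<le>n. of_bool (a + 1 + 2 * j < i \<and> i \<le> a + 2 * n + 5 + 2 * j)) + 4 * of_bool (a < i \<and> i \<le> ?a)) +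
     ((\<Sum>j\<le>n. of_bool (?a + 1 + 2 * j < i)) + 4 * of_bool (?a < i))"
    unfolding steps_edges.simps crossing_simps
    using Cons.prems by (intro add_mono crossing_step Cons.IH) auto
  also have "\<dots> = (\<Sum>j\<le>n. of_bool (a + 1 + 2 * j < i \<and> i \<le> a + 2 * n + 5 + 2 * j) +
     of_bool (?a + 1 + 2 * j < i)) + 4 * (of_bool (a < i \<and> i \<le> ?a) + of_bool (?a < i))"
    by (simp only: sum.distrib distrib_left add_ac)
  also have "\<dots> = (\<Sum>j\<le>n. of_bool (a + 1 + 2 * j < i)) + 4 * of_bool (a < i)"
    by (intro arg_cong2[where f = "(+)"] sum.cong) auto
  finally show ?case .
qed simp

lemma step_edges_bound:
  assumes "\<forall>c. t = Some c \<longrightarrow> c < 2 * n" and "(u, v) \<in> set (step_edges n a t)"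
  shows "u < v \<and> v \<le> a + 4 * n + 5"
  using assms by (auto simp: step_edges_def split: option.splits)

lemma steps_edges_bound:
  assumes "\<forall>c. Some c \<in> set ts \<longrightarrow> c < 2 * n" and "(u, v) \<in> set (steps_edges n a ts)"
  shows "u < v \<and> v \<le> a + (length ts + 1) * (2 * n + 4)"
  using assms
proof (induction ts arbitrary: a)
  case (Cons t ts)
  show ?case
  proof (cases "(u, v) \<in> set (step_edges n a t)")
    case True
    then have "u < v \<and> v \<le> a + 4 * n + 5" using Cons.prems step_edges_bound[of t n u v a] by auto
    moreover have "4 * n + 5 \<le> (length (t # ts) + 1) * (2 * n + 4)" by simp
    ultimately show ?thesis by linarith
  next
    case False
    then show ?thesis using Cons.IH[of "a + 2 * n + 4"] Cons.prems by (auto simp: algebra_simps)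
  qed
qed simp

lemma ising_edges_bound:
  assumes "\<forall>c. Some c \<in> set ts \<longrightarrow> c < 2 * n" and "(u, v) \<in> set (ising_edges n ts)"
  shows "u < v \<and> v < ising_order n ts"
  using assms(2) steps_edges_bound[OF assms(1), of u v 0]
  by (auto simp: ising_edges_def ising_order_def)

text \<open>There are \<open>n + 1\<close> columns and four further edges. The parallel edges lie to
  the right of all blocks, so no cut meets both kinds of edges.\<close>

lemma crossing_ising:
  assumes ts: "\<forall>c. Some c \<in> set ts \<longrightarrow> c < 2 * n"
  shows "crossing i (ising_edges n ts) \<le> n + 5"
proof -
  let ?p = "(length ts + 1) * (2 * n + 4)"
  have steps: "crossing i (steps_edges n 0 ts) \<le> n + 5"
  proof -
    have "(\<Sum>j\<le>n. of_bool (0 + 1 + 2 * j < i)) \<le> (\<Sum>j\<le>n. 1 :: nat)" by (intro sum_mono) simp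
    then show ?thesis using crossing_steps[OF ts, of i 0]
      by (cases "0 < i") (simp_all del: sum_of_bool_eq)
  qed
  show ?thesis
  proof (cases "?p + 1 < i")
    case True
    have "crossing i (steps_edges n 0 ts) = 0"
      using True steps_edges_bound[OF ts, of _ _ 0] unfolding crossing_def
      by (fastforce simp: filter_empty_conv)
    then show ?thesis unfolding ising_edges_def by (simp add: crossing_replicate)
  next
    case False
    then show ?thesis using steps unfolding ising_edges_def by (simp add: crossing_replicate)
  qed
qed

text \<open>Every ordering has a cut separating the two ends of the parallel edges, and all
  \<open>n + 5\<close> of them cross it. The natural ordering never exceeds this number.\<close>

lemma cutwidth_ising:
  assumes ts: "\<forall>c. Some c \<in> set ts \<longrightarrow> c < 2 * n"
  defines "G \<equiv> graph_of (ising_order n ts) (ising_edges n ts)"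
  shows "cutwidth G = n + 5" and "order_width G [0..<ising_order n ts] = n + 5"
proof -
  let ?m = "ising_order n ts" and ?es = "ising_edges n ts"
  let ?P = "permutations_of_set (verts G)"
  have verts: "verts G = {..<?m}" by (simp add: G_def graph_of_def)
  have id: "[0..<?m] \<in> ?P" unfolding verts by (auto simp: permutations_of_set_def)
  have fin: "finite (cut_edges G vs i)" for vs i
    by (rule finite_subset[of _ "{..<length ?es}"]) (auto simp: cut_edges_def G_def graph_of_def)
  have upper: "card (cut_edges G [0..<?m] i) \<le> n + 5" if "i \<le> ?m" for i
  proof -
    have "cut_edges G [0..<?m] i \<subseteq> {k. k < length ?es \<and> (case ?es ! k of (u, v) \<Rightarrow> u < i \<and> i \<le> v)}"
    proof
      fix k assume "k \<in> cut_edges G [0..<?m] i"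
      then obtain x y where k: "k < length ?es" and xy: "x < i" "i \<le> y"
        "{fst (?es ! k), snd (?es ! k)} = {x, y}"
        using that by (auto simp: cut_edges_def G_def graph_of_def)
      moreover have "fst (?es ! k) < snd (?es ! k)"
        using ising_edges_bound[OF ts, of "fst (?es ! k)" "snd (?es ! k)"] nth_mem[OF k] by simp
      ultimately show "k \<in> {k. k < length ?es \<and> (case ?es ! k of (u, v) \<Rightarrow> u < i \<and> i \<le> v)}"
        by (auto simp: doubleton_eq_iff case_prod_unfold)
    qed
    then have "card (cut_edges G [0..<?m] i) \<le> crossing i ?es"
      unfolding crossing_def length_filter_conv_card by (intro card_mono) auto
    then show ?thesis using crossing_ising[OF ts, of i] by linarith
  qed
  have lower: "n + 5 \<le> order_width G vs" if vs: "vs \<in> ?P" for vs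
  proof -
    let ?p = "(length ts + 1) * (2 * n + 4)" and ?L = "length (steps_edges n 0 ts)"
    have vs': "set vs = {..<?m}" "distinct vs"
      using vs by (auto simp: verts permutations_of_set_def)
    then have "?p + 1 \<in> set vs" "?p + 2 \<in> set vs" by (auto simp: ising_order_def)
    then obtain i j where ij: "i < length vs" "vs ! i = ?p + 1" "j < length vs" "vs ! j = ?p + 2"
      unfolding in_set_conv_nth by blast
    \<comment> \<open>The cut directly behind whichever end comes first; the other end lies beyond
      it.\<close>
    define c where "c = Suc (min i j)"
    have nth_take: "vs ! k \<in> set (take c vs)" if "k < c" "k < length vs" for k
      using that unfolding in_set_conv_nth by (intro exI[of _ k]) simp
    have nth_drop: "vs ! k \<in> set (drop c vs)" if "c \<le> k" "k < length vs" for k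
      using that nth_drop[of c vs "k - c"] nth_mem[of "k - c" "drop c vs"] by auto
    have sep: "\<exists>u\<in>set (take c vs). \<exists>v\<in>set (drop c vs). {?p + 1, ?p + 2} = {u, v}"
    proof (cases "i < j")
      case True
      then show ?thesis using nth_take[of i] nth_drop[of j] ij unfolding c_def by auto
    next
      case False
      then have "j < i" using ij by (cases "i = j") auto
      then show ?thesis using nth_take[of j] nth_drop[of i] ij unfolding c_def
        by (intro bexI[of _ "?p + 2"] bexI[of _ "?p + 1"]) auto
    qed
    \<comment> \<open>Edges are positions in the list, and the parallel ones occupy the last
      \<open>n + 5\<close> positions.\<close>
    have "{?L..<?L + (n + 5)} \<subseteq> cut_edges G vs c"
    proof
      fix k assume k: "k \<in> {?L..<?L + (n + 5)}"
      then have "?es ! k = (?p + 1, ?p + 2)" "k < length ?es"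
        unfolding ising_edges_def by (auto simp: nth_append)
      then show "k \<in> cut_edges G vs c"
        using sep unfolding cut_edges_def by (simp add: G_def graph_of_def del: One_nat_def)
    qed
    then have "card {?L..<?L + (n + 5)} \<le> card (cut_edges G vs c)" by (rule card_mono[OF fin])
    then have "n + 5 \<le> card (cut_edges G vs c)" by simp
    also have "\<dots> \<le> order_width G vs"
      unfolding order_width_def using ij by (intro Max_ge) (auto simp: c_def)
    finally show ?thesis .
  qed
  have "order_width G [0..<?m] \<le> n + 5"
    unfolding order_width_def using upper by (subst Max_le_iff) auto
  then show width: "order_width G [0..<?m] = n + 5" using lower[OF id] by simp
  show "cutwidth G = n + 5"
    unfolding cutwidth_def
  proof (rule Min_eqI)
    show "finite (order_width G ` ?P)" by simp
    show "n + 5 \<in> order_width G ` ?P" using id width by (metis imageI)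
    show "n + 5 \<le> w" if "w \<in> order_width G ` ?P" for w using that lower by blast
  qed
qed

lemma is_instance_ising:
  assumes "\<forall>c. Some c \<in> set ts \<longrightarrow> c < 2 * n"
  shows "is_instance (ising_order n ts) (ising_edges n ts) [0..<ising_order n ts]"
  unfolding is_instance_def
proof (intro conjI)
  show "\<forall>(u, v)\<in>set (ising_edges n ts). u < ising_order n ts \<and> v < ising_order n ts \<and> u \<noteq> v"
  proof (clarify, intro conjI)
    fix u v assume "(u, v) \<in> set (ising_edges n ts)"
    then have "u < v" "v < ising_order n ts" using ising_edges_bound[OF assms] by blast+
    then show "u < ising_order n ts" "v < ising_order n ts" "u \<noteq> v" by linarith+
  qed
  show "[0..<ising_order n ts] \<in> permutations_of_set {..<ising_order n ts}"
    by (auto simp: permutations_of_set_def)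
  show "0 < ising_order n ts" by (simp add: ising_order_def)
qed (simp only: cutwidth_ising[OF assms])

section \<open>Running times of programs\<close>

fun asize :: "aexp \<Rightarrow> nat" where
  "asize (N n) = 1"
| "asize (Cell a e) = asize e + 1"
| "asize (Add e f) = asize e + asize f + 1"
| "asize (Sub e f) = asize e + asize f + 1"
| "asize (Mul e f) = asize e + asize f + 1"
| "asize (Div e f) = asize e + asize f + 1"

text \<open>Differences and quotients need no bound of their own, as they never exceed their first
  operand. With all values at most \<open>U\<close>, each node of an expression costs at most
  \<open>bit_len U\<close>.\<close>

fun abound :: "nat \<Rightarrow> aexp \<Rightarrow> memory \<Rightarrow> bool" where
  "abound U (N n) s \<longleftrightarrow> n \<le> U"
| "abound U (Cell a e) s \<longleftrightarrow> abound U e s \<and> aval (Cell a e) s \<le> U"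
| "abound U (Add e f) s \<longleftrightarrow> abound U e s \<and> abound U f s \<and> aval (Add e f) s \<le> U"
| "abound U (Sub e f) s \<longleftrightarrow> abound U e s \<and> abound U f s"
| "abound U (Mul e f) s \<longleftrightarrow> abound U e s \<and> abound U f s \<and> aval (Mul e f) s \<le> U"
| "abound U (Div e f) s \<longleftrightarrow> abound U e s \<and> abound U f s"

lemma bit_len_mono: "m \<le> n \<Longrightarrow> bit_len m \<le> bit_len n"
  unfolding bit_len_def using floorlog_mono[of m n 2] by (intro max.mono) simp_all

lemma bit_len_pos: "1 \<le> bit_len n"
  by (simp add: bit_len_def)

lemma bit_len_power2: "bit_len (2 ^ n) = n + 1"
  by (simp add: bit_len_def floorlog_def)

lemma bit_len_le: "1 \<le> n \<Longrightarrow> bit_len n \<le> n + 1"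
  using bit_len_mono[of n "2 ^ n"] by (simp add: bit_len_power2 less_imp_le)

lemma aval_le: "abound U e s \<Longrightarrow> aval e s \<le> U"
proof (induction e)
  case (Div e f)
  then show ?case by (simp add: order_trans[OF div_le_dividend])
qed auto

lemma acost_le: "abound U e s \<Longrightarrow> acost e s \<le> asize e * bit_len U"
proof (induction e)
  case (N n)
  then show ?case by (simp add: bit_len_mono)
next
  case (Cell a e)
  then show ?case using bit_len_mono[OF aval_le[OF Cell.prems]] by simp
next
  case (Add e f)
  then show ?case using bit_len_mono[OF aval_le[OF Add.prems]] by (simp add: algebra_simps)
next
  case (Sub e f)
  then show ?case using bit_len_mono[OF aval_le[OF Sub.prems]] by (simp add: algebra_simps)
next
  case (Mul e f)
  then show ?case using bit_len_mono[OF aval_le[OF Mul.prems]] by (simp add: algebra_simps)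
next
  case (Div e f)
  then show ?case using bit_len_mono[OF aval_le[OF Div.prems]] by (simp add: algebra_simps)
qed

section \<open>Time-bounded total correctness\<close>

definition achieves :: "com \<Rightarrow> memory \<Rightarrow> nat \<Rightarrow> (memory \<Rightarrow> bool) \<Rightarrow> bool" where
  "achieves c s T Q \<longleftrightarrow> (\<exists>t s'. exec c s t s' \<and> t \<le> T \<and> Q s')"

lemma achieves_mono:
  "achieves c s T Q \<Longrightarrow> T \<le> T' \<Longrightarrow> (\<And>s'. Q s' \<Longrightarrow> Q' s') \<Longrightarrow> achieves c s T' Q'"
  unfolding achieves_def by (meson order_trans)

lemma achieves_Seq:
  assumes "achieves c s T P" and "\<And>s'. P s' \<Longrightarrow> achieves d s' T' Q"
  shows "achieves (Seq c d) s (T + T') Q"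
  using assms unfolding achieves_def by (meson add_mono exec.Seq)

text \<open>The index of the invariant is the exact number of rounds left. It gives termination and
  the time bound at once.\<close>

lemma achieves_While:
  assumes "I k s"
    and test: "\<And>k s. I k s \<Longrightarrow> (aval b s = 0 \<longleftrightarrow> k = 0) \<and> acost b s \<le> tb"
    and body: "\<And>k s. I (Suc k) s \<Longrightarrow> achieves c s T (I k)"
  shows "achieves (While b c) s (k * (1 + tb + T) + (1 + tb)) (I 0)"
  using \<open>I k s\<close>
proof (induction k arbitrary: s)
  case 0
  then have "exec (While b c) s (1 + acost b s) s" using test[of 0 s] by (intro exec.WhileFalse) simp
  then show ?case using 0 test[of 0 s] unfolding achieves_def by (intro exI[of _ "1 + acost b s"] exI[of _ s]) simp
next
  case (Suc k)
  obtain t s' where c: "exec c s t s'" "t \<le> T" "I k s'"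
    using body[OF Suc.prems] by (auto simp: achieves_def)
  obtain t' s'' where w: "exec (While b c) s' t' s''" "t' \<le> k * (1 + tb + T) + (1 + tb)" "I 0 s''"
    using Suc.IH[OF c(3)] by (auto simp: achieves_def)
  have "exec (While b c) s (1 + acost b s + t + t') s''"
    using test[OF Suc.prems] c w by (intro exec.WhileTrue) auto
  moreover have "1 + acost b s + t + t' \<le> Suc k * (1 + tb + T) + (1 + tb)"
    using test[OF Suc.prems] c w by simp
  ultimately show ?case using w unfolding achieves_def by blast
qed

text \<open>For loop-free programs the final memory and a bound on the running time can be computed.
  A loop makes \<open>cbound\<close> false, so the values of \<open>run\<close> and \<open>csize\<close> on loops do not matter.\<close>

fun run :: "com \<Rightarrow> memory \<Rightarrow> memory" where
  "run Skip s = s"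
| "run (Store a i e) s = s(a := (s a)(aval i s := aval e s))"
| "run (Seq c d) s = run d (run c s)"
| "run (If b c d) s = (if aval b s \<noteq> 0 then run c s else run d s)"
| "run (While b c) s = s"

fun csize :: "com \<Rightarrow> nat" where
  "csize Skip = 1"
| "csize (Store a i e) = 1 + asize i + asize e"
| "csize (Seq c d) = csize c + csize d"
| "csize (If b c d) = 1 + asize b + csize c + csize d"
| "csize (While b c) = 0"

fun cbound :: "nat \<Rightarrow> com \<Rightarrow> memory \<Rightarrow> bool" where
  "cbound U Skip s \<longleftrightarrow> True"
| "cbound U (Store a i e) s \<longleftrightarrow> abound U i s \<and> abound U e s"
| "cbound U (Seq c d) s \<longleftrightarrow> cbound U c s \<and> cbound U d (run c s)"
| "cbound U (If b c d) s \<longleftrightarrow> abound U b s \<and> (if aval b s \<noteq> 0 then cbound U c s else cbound U d s)"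
| "cbound U (While b c) s \<longleftrightarrow> False"

text \<open>Since \<open>bit_len U\<close> is at least 1, it also absorbs the unit charges of the
  commands.\<close>

lemma exec_run: "cbound U c s \<Longrightarrow> \<exists>t\<le>csize c * bit_len U. exec c s t (run c s)"
proof (induction c arbitrary: s)
  case Skip
  then show ?case using exec.Skip bit_len_pos by force
next
  case (Store a i e)
  then have "1 + acost i s + acost e s \<le> csize (Store a i e) * bit_len U"
    using acost_le[of U i s] acost_le[of U e s] bit_len_pos[of U] by (simp add: algebra_simps)
  then show ?case using exec.Store[of a i e s] unfolding run.simps by blast
next
  case (Seq c d)
  then obtain t t' where "exec c s t (run c s)" "t \<le> csize c * bit_len U"
    "exec d (run c s) t' (run d (run c s))" "t' \<le> csize d * bit_len U" by (meson cbound.simps(3))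
  then show ?case
    using exec.Seq[of c s t "run c s" d t' "run d (run c s)"]
    by (intro exI[of _ "t + t'"]) (simp add: add_mono distrib_right)
next
  case (If b c d)
  note test = acost_le[of U b s] bit_len_pos[of U]
  show ?case
  proof (cases "aval b s = 0")
    case True
    then obtain t where "exec d s t (run d s)" "t \<le> csize d * bit_len U" using If by auto
    then show ?thesis using If.prems True test exec.IfFalse[of b s d t "run d s" c]
      by (intro exI[of _ "1 + acost b s + t"]) (simp add: distrib_right)
  next
    case False
    then obtain t where "exec c s t (run c s)" "t \<le> csize c * bit_len U" using If by auto
    then show ?thesis using If.prems False test exec.IfTrue[of b s c t "run c s" d]
      by (intro exI[of _ "1 + acost b s + t"]) (simp add: distrib_right)
  qed
qed simp

lemma achieves_run:
  assumes "cbound U c s" and "Q (run c s)" and "csize c * bit_len U \<le> T"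
  shows "achieves c s T Q"
  using exec_run[OF assms(1)] assms(2,3) unfolding achieves_def by (meson order_trans)

section \<open>Moving a program to fresh arrays\<close>

fun shift_aexp :: "nat \<Rightarrow> aexp \<Rightarrow> aexp" where
  "shift_aexp k (N n) = N n"
| "shift_aexp k (Cell a e) = Cell (k + a) (shift_aexp k e)"
| "shift_aexp k (Add e f) = Add (shift_aexp k e) (shift_aexp k f)"
| "shift_aexp k (Sub e f) = Sub (shift_aexp k e) (shift_aexp k f)"
| "shift_aexp k (Mul e f) = Mul (shift_aexp k e) (shift_aexp k f)"
| "shift_aexp k (Div e f) = Div (shift_aexp k e) (shift_aexp k f)"

fun shift_com :: "nat \<Rightarrow> com \<Rightarrow> com" where
  "shift_com k Skip = Skip"
| "shift_com k (Store a i e) = Store (k + a) (shift_aexp k i) (shift_aexp k e)"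
| "shift_com k (Seq c d) = Seq (shift_com k c) (shift_com k d)"
| "shift_com k (If b c d) = If (shift_aexp k b) (shift_com k c) (shift_com k d)"
| "shift_com k (While b c) = While (shift_aexp k b) (shift_com k c)"

lemma shift_aexp_correct:
  "(\<And>a. s' (k + a) = s a) \<Longrightarrow> aval (shift_aexp k e) s' = aval e s \<and> acost (shift_aexp k e) s' = acost e s"
  by (induction e) auto

text \<open>The cost model charges addresses and values but not the names of arrays, so renaming
  preserves the running time exactly. The arrays below \<open>k\<close> are free to keep data for
  later.\<close>

lemma exec_shift:
  assumes "exec c s t s'"
  shows "exec (shift_com k c) (\<lambda>a. if a < k then r a else s (a - k)) t (\<lambda>a. if a < k then r a else s' (a - k))"
  using assms
proof (induction rule: exec.induct)
  case (Store a i e s)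
  let ?s = "\<lambda>a. if a < k then r a else s (a - k)"
  have "exec (shift_com k (Store a i e)) ?s
     (1 + acost (shift_aexp k i) ?s + acost (shift_aexp k e) ?s)
     (?s(k + a := (?s (k + a))(aval (shift_aexp k i) ?s := aval (shift_aexp k e) ?s)))"
    unfolding shift_com.simps by (rule exec.Store)
  moreover have "?s(k + a := (?s (k + a))(aval i s := aval e s)) =
      (\<lambda>b. if b < k then r b else (s(a := (s a)(aval i s := aval e s))) (b - k))"
    by (rule ext) auto
  ultimately show ?case
    using shift_aexp_correct[of ?s k s] by simp
next
  case (Seq c s t s' d t' s'')
  then show ?case by (auto intro: exec.Seq)
next
  case (IfTrue b s c t s' d)
  let ?s = "\<lambda>a. if a < k then r a else s (a - k)"
  have e: "aval (shift_aexp k b) ?s = aval b s" "acost (shift_aexp k b) ?s = acost b s"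
    using shift_aexp_correct[of ?s k s b] by auto
  show ?case using exec.IfTrue[of "shift_aexp k b" ?s] IfTrue unfolding e by simp
next
  case (IfFalse b s d t s' c)
  let ?s = "\<lambda>a. if a < k then r a else s (a - k)"
  have e: "aval (shift_aexp k b) ?s = aval b s" "acost (shift_aexp k b) ?s = acost b s"
    using shift_aexp_correct[of ?s k s b] by auto
  show ?case using exec.IfFalse[of "shift_aexp k b" ?s] IfFalse unfolding e by simp
next
  case (WhileFalse b s c)
  let ?s = "\<lambda>a. if a < k then r a else s (a - k)"
  have e: "aval (shift_aexp k b) ?s = aval b s" "acost (shift_aexp k b) ?s = acost b s"
    using shift_aexp_correct[of ?s k s b] by auto
  show ?case using exec.WhileFalse[of "shift_aexp k b" ?s] WhileFalse unfolding e by simp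
next
  case (WhileTrue b s c t s' t' s'')
  let ?s = "\<lambda>a. if a < k then r a else s (a - k)"
  have e: "aval (shift_aexp k b) ?s = aval b s" "acost (shift_aexp k b) ?s = acost b s"
    using shift_aexp_correct[of ?s k s b] by auto
  show ?case using exec.WhileTrue[of "shift_aexp k b" ?s] WhileTrue unfolding e by simp
qed (simp add: exec.Skip[unfolded One_nat_def])

section \<open>The reduction as a program\<close>

abbreviation Var :: "nat \<Rightarrow> aexp" where
  "Var a \<equiv> Cell a (N 0)"

abbreviation Set_Var :: "nat \<Rightarrow> aexp \<Rightarrow> com" where
  "Set_Var a e \<equiv> Store a (N 0) e"

fun block :: "com list \<Rightarrow> com" where
  "block [] = Skip"
| "block (c # cs) = Seq c (block cs)"

definition arr :: "nat list \<Rightarrow> nat \<Rightarrow> nat" where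
  "arr w i = (if i < length w then w ! i else 0)"

lemma arr_snoc: "(arr w)(length w := x) = arr (w @ [x])"
  by (rule ext) (auto simp: arr_def nth_append)

lemma init_memory_0 [simp]: "init_memory w 0 = arr w"
  by (rule ext) (auto simp: init_memory_def arr_def)

lemma init_memory_nonzero [simp]: "a \<noteq> 0 \<Longrightarrow> init_memory w a = (\<lambda>_. 0)"
  by (rule ext) (simp add: init_memory_def)

text \<open>Array 20 collects the instance, and variable 9 holds the number of cells written so far. The
  variables 2 to 8 hold the number \<open>n\<close> of variables of the formula, the block length \<open>2 * n + 4\<close>, the
  number of clauses still to be read, the position in the input, the vertex \<open>a\<close> preceding the
  current block (in the end the number of vertices), the number of literals still to be read in the
  current clause, and the number of literals read.\<close>

definition written :: "memory \<Rightarrow> nat list \<Rightarrow> bool" where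
  "written s w \<longleftrightarrow> s 20 = arr w \<and> s 9 0 = length w"

definition push :: "memory \<Rightarrow> nat \<Rightarrow> nat \<Rightarrow> memory" where
  "push s x y = s(20 := (s 20)(s 9 0 := x, s 9 0 + 1 := y), 9 := (s 9)(0 := s 9 0 + 2))"

definition emit :: "aexp \<Rightarrow> aexp \<Rightarrow> com" where
  "emit e f = block [Store 20 (Var 9) e, Store 20 (Add (Var 9) (N 1)) f, Set_Var 9 (Add (Var 9) (N 2))]"

text \<open>\<open>emit\<close> evaluates its second expression after a write to array 20, so that
  expression must not read the array.\<close>

fun avoids :: "aexp \<Rightarrow> bool" where
  "avoids (N n) = True"
| "avoids (Cell a e) \<longleftrightarrow> a \<noteq> 20 \<and> avoids e"
| "avoids (Add e f) \<longleftrightarrow> avoids e \<and> avoids f"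
| "avoids (Sub e f) \<longleftrightarrow> avoids e \<and> avoids f"
| "avoids (Mul e f) \<longleftrightarrow> avoids e \<and> avoids f"
| "avoids (Div e f) \<longleftrightarrow> avoids e \<and> avoids f"

lemma avoids_upd:
  "avoids e \<Longrightarrow> aval e (s(20 := f)) = aval e s \<and> abound U e (s(20 := f)) = abound U e s"
  by (induction e) auto

lemma run_emit: "avoids f \<Longrightarrow> run (emit e f) s = push s (aval e s) (aval f s)"
  by (simp add: emit_def push_def avoids_upd fun_eq_iff)

lemma cbound_emit:
  "avoids f \<Longrightarrow> cbound U (emit e f) s \<longleftrightarrow> abound U e s \<and> abound U f s \<and> s 9 0 + 2 \<le> U"
  by (auto simp: emit_def avoids_upd)

lemma push_simps [simp]:
  "b \<noteq> 9 \<Longrightarrow> b \<noteq> 20 \<Longrightarrow> push s x y b = s b"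
  "push s x y 9 0 = s 9 0 + 2"
  by (auto simp: push_def)

lemma written_push: "written s w \<Longrightarrow> written (push s x y) (w @ [x, y])"
proof -
  assume w: "written s w"
  have "(arr w)(length w := x, length w + 1 := y) = arr (w @ [x, y])"
    using arr_snoc[of "w @ [x]" y] by (simp add: arr_snoc)
  then show ?thesis using w by (simp add: written_def push_def)
qed

lemma written_push': "written s w \<Longrightarrow> x = x' \<Longrightarrow> y = y' \<Longrightarrow> written (push s x y) (w @ [x', y'])"
  using written_push by simp

lemma written_upd [simp]: "b \<noteq> 9 \<Longrightarrow> b \<noteq> 20 \<Longrightarrow> written (s(b := f)) w = written s w"
  by (simp add: written_def)

lemma written_9: "written s w \<Longrightarrow> s 9 0 = length w"
  by (simp add: written_def)

section \<open>Writing the blocks\<close>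

definition flat :: "(nat \<times> nat) list \<Rightarrow> nat list" where
  "flat es = concat (map (\<lambda>(u, v). [u, v]) es)"

lemma flat_simps [simp]:
  "flat [] = []" "flat ((u, v) # es) = u # v # flat es" "flat (es @ fs) = flat es @ flat fs"
  by (auto simp: flat_def)

lemma length_flat [simp]: "length (flat es) = 2 * length es"
  by (induction es) auto

definition links :: "nat \<Rightarrow> nat \<Rightarrow> nat \<Rightarrow> (nat \<times> nat) list" where
  "links a d k = concat (map (\<lambda>j. [(a + 1 + 2 * j, a + 2 + 2 * j), (a + 2 + 2 * j, a + d + 1 + 2 * j)]) [0..<k])"

lemma links_simps [simp]:
  "links a d 0 = []"
  "links a d (Suc k) = links a d k @ [(a + 1 + 2 * k, a + 2 + 2 * k), (a + 2 + 2 * k, a + d + 1 + 2 * k)]"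
  by (auto simp: links_def)

lemma length_links [simp]: "length (links a d k) = 2 * k"
  by (induction k) auto

definition link_body :: com where
  "link_body = block
     [emit (Add (Var 12) (N 1)) (Add (Var 12) (N 2)),
      emit (Add (Var 12) (N 2)) (Add (Add (Var 12) (Var 3)) (N 1)),
      Set_Var 12 (Add (Var 12) (N 2)), Set_Var 11 (Sub (Var 11) (N 1))]"

text \<open>In the factor 84, 80 bounds the size of the body, and the rest pays for the loop test.
  The factors of the later loops arise in the same way.\<close>

lemma link_loop:
  assumes "written s w" "s 12 0 = a" "s 3 0 = d" "s 11 0 = k"
    and U: "length w + 4 * k \<le> U" "a + 2 * k + d + 1 \<le> U" "2 \<le> U"
  shows "achieves (While (Var 11) link_body) s ((k + 1) * (84 * bit_len U))
     (\<lambda>s'. written s' (w @ flat (links a d k)) \<and> s' 12 0 = a + 2 * k \<and>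
        (\<forall>b. b \<notin> {9, 11, 12, 20} \<longrightarrow> s' b = s b))"
proof -
  \<comment> \<open>\<open>i\<close> is the number of rounds left, so \<open>k - i\<close> columns
    have been written.\<close>
  define I where "I i s' \<longleftrightarrow> i \<le> k \<and> written s' (w @ flat (links a d (k - i))) \<and> s' 12 0 = a + 2 * (k - i) \<and>
     s' 11 0 = i \<and> (\<forall>b. b \<notin> {9, 11, 12, 20} \<longrightarrow> s' b = s b)" for i s'
  have "achieves (While (Var 11) link_body) s
      (k * (1 + 2 * bit_len U + 80 * bit_len U) + (1 + 2 * bit_len U)) (I 0)"
  proof (rule achieves_While)
    show "I k s" using assms by (simp add: I_def)
    show "(aval (Var 11) s' = 0 \<longleftrightarrow> i = 0) \<and> acost (Var 11) s' \<le> 2 * bit_len U" if "I i s'" for i s'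
      using that U acost_le[of U "Var 11" s'] by (auto simp: I_def)
  next
    fix i s' assume I: "I (Suc i) s'"
    then obtain j where j: "k = Suc i + j" unfolding I_def by (metis add.commute le_iff_add)
    have s': "written s' (w @ flat (links a d j))" "s' 12 0 = a + 2 * j" "s' 11 0 = Suc i" "s' 3 0 = d"
      "s' 9 0 = length w + 4 * j" "\<forall>b. b \<notin> {9, 11, 12, 20} \<longrightarrow> s' b = s b"
      using I assms j by (auto simp: I_def dest: written_9)
    show "achieves link_body s' (80 * bit_len U) (I i)"
    proof (rule achieves_run[where U = U])
      show "cbound U link_body s'"
        using s'(2-5) U j by (simp add: link_body_def cbound_emit run_emit)
      have "written (run link_body s') (w @ flat (links a d (Suc j)))"
        using written_push[OF written_push[OF s'(1)]] s'(2-5)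
        by (simp add: link_body_def run_emit add_ac)
      then show "I i (run link_body s')"
        using s'(2-6) j by (simp add: I_def link_body_def run_emit)
      show "csize link_body * bit_len U \<le> 80 * bit_len U"
        by (simp add: link_body_def emit_def)
    qed
  qed
  then show ?thesis
  proof (rule achieves_mono)
    have "1 + 2 * bit_len U + 80 * bit_len U \<le> 84 * bit_len U" "1 + 2 * bit_len U \<le> 84 * bit_len U"
      using bit_len_pos[of U] by auto
    then show "k * (1 + 2 * bit_len U + 80 * bit_len U) + (1 + 2 * bit_len U) \<le> (k + 1) * (84 * bit_len U)"
      by (metis add_mono add_mult_distrib mult.left_neutral mult_le_mono2)
  qed (auto simp: I_def)
qed


text \<open>After the path loop variable 12 holds \<open>a + 2 * n + 2\<close>, the vertex of the
  constant true; the remaining vertices of the block are addressed from there. A nonzero variable 7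
  means that the token is a literal. Otherwise it is a separator, after which the length of the next
  clause is loaded, or variable 10 is cleared to stop the main loop.\<close>

definition step_tail :: com where
  "step_tail = block
     [emit (Add (Var 12) (N 1)) (Add (Var 12) (N 2)),
      If (Var 7)
        (block
          [Set_Var 13 (Cell 0 (Var 5)),
           emit (Var 6) (Add (Add (Var 6) (N 1)) (Var 13)),
           emit (Add (Add (Var 6) (N 1)) (Var 13)) (Add (Var 12) (N 1)),
           emit (Var 6) (Add (Var 12) (N 1)),
           Set_Var 7 (Sub (Var 7) (N 1)), Set_Var 8 (Add (Var 8) (N 1)), Set_Var 5 (Add (Var 5) (N 1))])
        (block
          [emit (Var 6) (Sub (Var 12) (N 1)), emit (Var 12) (Add (Var 12) (N 2)),
           If (Var 4)
             (block [Set_Var 7 (Cell 0 (Var 5)), Set_Var 4 (Sub (Var 4) (N 1)), Set_Var 5 (Add (Var 5) (N 1))])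
             (Set_Var 10 (N 0))]),
      Set_Var 6 (Add (Var 6) (Var 3))]"

definition step_body :: com where
  "step_body = Seq (Seq (Set_Var 12 (Var 6)) (Set_Var 11 (Add (Var 2) (N 1))))
     (Seq (While (Var 11) link_body) step_tail)"

definition clause_codes :: "(nat \<times> bool) list \<Rightarrow> nat list" where
  "clause_codes C = map (\<lambda>(v, b). 2 * v + of_bool b) C"

lemma tokens_simps:
  "tokens [] = [None]"
  "tokens (C # F) = None # map Some (clause_codes C) @ tokens F"
  by (auto simp: tokens_def clause_codes_def)

definition clauses_word :: "cnf \<Rightarrow> nat list" where
  "clauses_word F = concat (map (\<lambda>C. length C # clause_codes C) F)"

lemma encode_cnf_eq: "encode_cnf n F = [n, length F] @ clauses_word F"
  by (simp add: encode_cnf_def clauses_word_def clause_codes_def)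

text \<open>The separator before a clause matches the input cell holding the length of that clause;
  only the final separator has no cell.\<close>

lemma length_tokens: "length (tokens F) = Suc (length (clauses_word F))"
  by (induction F) (auto simp: tokens_simps clauses_word_def)

text \<open>After the literals \<open>R\<close> of the current clause, the clauses \<open>F\<close> remain to be read.\<close>

definition unread :: "memory \<Rightarrow> nat list \<Rightarrow> nat list \<Rightarrow> cnf \<Rightarrow> bool" where
  "unread s w R F \<longleftrightarrow> s 0 = arr w \<and> s 5 0 \<le> length w \<and> drop (s 5 0) w = R @ clauses_word F \<and>
     s 7 0 = length R \<and> s 4 0 = length F"

lemma unread_nth:
  assumes "s 0 = arr w" and "i \<le> length w" and "drop i w = x # xs"
  shows "s 0 i = x" and "Suc i \<le> length w" and "drop (Suc i) w = xs"
proof -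
  have "i < length w" using assms(2,3) by (cases "i = length w") auto
  then show "s 0 i = x" "Suc i \<le> length w" "drop (Suc i) w = xs"
    using assms by (auto simp: arr_def Cons_nth_drop_Suc[symmetric])
qed

lemma step_edges_eq:
  "step_edges n a t = links a (2 * n + 4) (n + 1) @ (a + 2 * n + 3, a + 2 * n + 4) #
     (case t of
        None \<Rightarrow> [(a, a + 2 * n + 1), (a + 2 * n + 2, a + 2 * n + 4)]
      | Some c \<Rightarrow> [(a, a + 1 + c), (a + 1 + c, a + 2 * n + 3), (a, a + 2 * n + 3)])"
  by (simp add: step_edges_def links_def add_ac)

text \<open>The invariant of the main loop: \<open>us\<close> are the tokens processed, \<open>ts\<close> those still to come.\<close>

definition step_inv :: "nat \<Rightarrow> nat list \<Rightarrow> nat option list \<Rightarrow> nat option list \<Rightarrow> memory \<Rightarrow> bool" where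
  "step_inv n w us ts s \<longleftrightarrow>
     s 2 0 = n \<and> s 3 0 = 2 * n + 4 \<and> s 6 0 = length us * (2 * n + 4) \<and> s 8 0 = num_literals us \<and>
     written s ([0, 0] @ flat (steps_edges n 0 us)) \<and> (\<forall>b>20. s b = (\<lambda>_. 0)) \<and>
     (if ts = [] then s 10 0 = 0
      else s 10 0 = 1 \<and> (\<exists>R F. ts = map Some R @ tokens F \<and> unread s w R F))"

lemma steps_edges_append:
  "steps_edges n a (us @ vs) = steps_edges n a us @ steps_edges n (a + length us * (2 * n + 4)) vs"
  by (induction us arbitrary: a) (auto simp: algebra_simps)

lemma num_literals_append: "num_literals (us @ vs) = num_literals us + num_literals vs"
  by (induction us) auto

lemma length_step_edges: "length (step_edges n a t) \<le> 2 * n + 6"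
  by (auto simp: step_edges_eq split: option.split)

lemma length_steps_edges: "length (steps_edges n a ts) \<le> length ts * (2 * n + 6)"
proof (induction ts arbitrary: a)
  case (Cons t ts)
  show ?case using length_step_edges[of n a t] Cons.IH[of "a + 2 * n + 4"] by simp
qed simp

lemma step_correct:
  assumes inv: "step_inv n w us (t # ts) s"
    and codes: "\<forall>c. Some c \<in> set (t # ts) \<longrightarrow> c < 2 * n"
    and U: "(length us + length ts + 2) * (6 * n + 20) \<le> U" "length w \<le> length us + length ts + 2"
  shows "achieves step_body s ((n + 3) * (400 * bit_len U)) (step_inv n w (us @ [t]) ts)"
proof -
  let ?a = "length us * (2 * n + 4)" and ?w = "[0, 0] @ flat (steps_edges n 0 us)"
  let ?L = "flat (links ?a (2 * n + 4) (n + 1))"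
  have s: "s 2 0 = n" "s 3 0 = 2 * n + 4" "s 6 0 = ?a" "s 8 0 = num_literals us" "written s ?w"
    "\<forall>b>20. s b = (\<lambda>_. 0)" "s 10 0 = 1"
    using inv by (auto simp: step_inv_def)
  obtain R F where RF: "t # ts = map Some R @ tokens F" and unread: "unread s w R F"
    using inv by (auto simp: step_inv_def)
  \<comment> \<open>\<open>U\<close> has to dominate the write position, which grows by up to
    \<open>2 * (2 * n + 6)\<close> per token, together with the vertex numbers of the current
    block.\<close>
  have U': "length ?w + ?a + 6 * n + 30 \<le> U" "length us + length ts + 10 \<le> U"
  proof -
    define x y z where "x = length us * (2 * n + 6)" and "y = ?a" and "z = length ts * (6 * n + 20)"
    have "2 * x + y + 4 * length us + z + (12 * n + 40) \<le> U"
      using U(1) unfolding x_def y_def z_def by (simp add: algebra_simps)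
    moreover have "length ts \<le> z" by (simp add: z_def)
    moreover have "length ?w \<le> 2 + 2 * x"
      using length_steps_edges[of n 0 us] unfolding x_def by simp
    ultimately show "length ?w + ?a + 6 * n + 30 \<le> U" "length us + length ts + 10 \<le> U"
      unfolding y_def[symmetric] by linarith+
  qed
  have nl: "num_literals us \<le> length us" for us by (induction us) auto
  let ?s0 = "s(12 := (s 12)(0 := ?a), 11 := (s 11)(0 := n + 1))"
  have "achieves (Seq (Set_Var 12 (Var 6)) (Set_Var 11 (Add (Var 2) (N 1)))) s (20 * bit_len U)
      (\<lambda>s'. s' = ?s0)"
    using s U' by (intro achieves_run[where U = U]) auto
  then have pre: "achieves (Seq (Seq (Set_Var 12 (Var 6)) (Set_Var 11 (Add (Var 2) (N 1))))
       (Seq (While (Var 11) link_body) step_tail)) s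
       (20 * bit_len U + ((n + 1 + 1) * (84 * bit_len U) + 300 * bit_len U)) (step_inv n w (us @ [t]) ts)"
  proof (rule achieves_Seq)
    fix s' assume s'_eq: "s' = ?s0"
    have "achieves (While (Var 11) link_body) ?s0 ((n + 1 + 1) * (84 * bit_len U))
      (\<lambda>s'. written s' (?w @ ?L) \<and> s' 12 0 = ?a + 2 * (n + 1) \<and> (\<forall>b. b \<notin> {9, 11, 12, 20} \<longrightarrow> s' b = ?s0 b))"
      using s U' by (intro link_loop) auto
    then show "achieves (Seq (While (Var 11) link_body) step_tail) s'
       ((n + 1 + 1) * (84 * bit_len U) + 300 * bit_len U) (step_inv n w (us @ [t]) ts)"
      unfolding s'_eq
    proof (rule achieves_Seq)
      fix s'
      assume "written s' (?w @ ?L) \<and> s' 12 0 = ?a + 2 * (n + 1) \<and> (\<forall>b. b \<notin> {9, 11, 12, 20} \<longrightarrow> s' b = ?s0 b)"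
      then have s'w: "written s' (?w @ ?L)" and s': "s' 12 0 = ?a + 2 * (n + 1)" "s' 2 0 = n" "s' 3 0 = 2 * n + 4"
          "s' 6 0 = ?a" "s' 8 0 = num_literals us" "\<forall>b>20. s' b = (\<lambda>_. 0)" "s' 10 0 = 1"
        and un: "s' 0 = arr w" "s' 5 0 \<le> length w" "drop (s' 5 0) w = R @ clauses_word F"
          "s' 7 0 = length R" "s' 4 0 = length F"
        and len: "s' 9 0 = length ?w + 4 * n + 4"
        using s unread by (auto simp: unread_def dest: written_9)
      have Fl: "length F \<le> length us + length ts + 2" "length R \<le> length us + length ts + 2"
      proof -
        have "length F \<le> length (tokens F)" by (induction F) (auto simp: tokens_simps)
        moreover have "Suc (length ts) = length R + length (tokens F)" using arg_cong[OF RF, of length] by simp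
        ultimately show "length F \<le> length us + length ts + 2" "length R \<le> length us + length ts + 2" by linarith+
      qed
      define W where "W = ?w @ ?L"
      have s'w: "written s' W" using s'w by (simp add: W_def)
      have edges: "steps_edges n 0 (us @ [t]) = steps_edges n 0 us @ step_edges n ?a t"
        by (simp add: steps_edges_append)
      note U'' = U' U(2) Fl nl[of us]
      show "achieves step_tail s' (300 * bit_len U) (step_inv n w (us @ [t]) ts)"
      proof (rule achieves_run[where U = U])
        show "csize step_tail * bit_len U \<le> 300 * bit_len U"
          by (simp add: step_tail_def emit_def)
        \<comment> \<open>A nonempty \<open>R\<close> makes the token a literal. If \<open>R\<close>
          is empty the token is a separator, and \<open>F\<close> decides whether a clause follows
          or the input ends.\<close>
        have "cbound U step_tail s' \<and> step_inv n w (us @ [t]) ts (run step_tail s')"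
        proof (cases R)
          case (Cons c R')
          then have t: "t = Some c" and ts: "ts = map Some R' @ tokens F" using RF by auto
          then have c: "c < 2 * n" using codes by simp
          note rd = unread_nth[of s' w "s' 5 0" c "R' @ clauses_word F", OF un(1,2) un(3)[unfolded Cons append_Cons]]
          have cb: "cbound U step_tail s'"
            using s' len un rd(1) Cons c U''
            by (simp add: step_tail_def cbound_emit run_emit)
          have "written (run step_tail s') ((((W @ [?a + 2 * n + 3, ?a + 2 * n + 4]) @ [?a, ?a + 1 + c]) @
              [?a + 1 + c, ?a + 2 * n + 3]) @ [?a, ?a + 2 * n + 3])"
            using s'w s' un rd(1) Cons
            by (simp add: step_tail_def run_emit written_push' add_ac del: append_assoc)
          also have "\<dots> = [0, 0] @ flat (steps_edges n 0 (us @ [t]))"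
            unfolding edges unfolding W_def step_edges_eq t by simp
          finally have wr: "written (run step_tail s') ([0, 0] @ flat (steps_edges n 0 (us @ [t])))" .
          have "ts \<noteq> []" using ts by (cases F) (auto simp: tokens_simps)
          moreover have "unread (run step_tail s') w R' F"
            using s' un rd Cons by (simp add: step_tail_def run_emit unread_def)
          ultimately have "step_inv n w (us @ [t]) ts (run step_tail s')"
            using s' un rd(1) Cons wr ts unfolding step_inv_def
            by (auto simp: step_tail_def run_emit num_literals_append t)
          with cb show ?thesis ..
        next
          case Nil
          then have t: "t = None" using RF by (cases F) (auto simp: tokens_simps)
          have "written (run step_tail s') (((W @ [?a + 2 * n + 3, ?a + 2 * n + 4]) @ [?a, ?a + 2 * n + 1]) @
              [?a + 2 * n + 2, ?a + 2 * n + 4])"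
            using s'w s' un Nil
            by (simp add: step_tail_def run_emit written_push' add_ac del: append_assoc)
          also have "\<dots> = [0, 0] @ flat (steps_edges n 0 (us @ [t]))"
            unfolding edges unfolding W_def step_edges_eq t by simp
          finally have wr: "written (run step_tail s') ([0, 0] @ flat (steps_edges n 0 (us @ [t])))" .
          show ?thesis
          proof (cases F)
            case (Cons C F')
            then have ts: "ts = map Some (clause_codes C) @ tokens F'" using RF Nil by (simp add: tokens_simps)
            note rd = unread_nth[of s' w "s' 5 0" "length C" "clause_codes C @ clauses_word F'", OF un(1,2)]
            have rd: "s' 0 (s' 5 0) = length C" "Suc (s' 5 0) \<le> length w"
                "drop (Suc (s' 5 0)) w = clause_codes C @ clauses_word F'"
              using rd un(3) Nil Cons by (simp_all add: clauses_word_def)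
            have "length C \<le> length ts" using ts by (simp add: clause_codes_def)
            then have cb: "cbound U step_tail s'"
              using s' len un rd(1) Nil Cons U''
              by (simp add: step_tail_def cbound_emit run_emit)
            have "ts \<noteq> []" using ts by (cases F') (auto simp: tokens_simps)
            moreover have "unread (run step_tail s') w (clause_codes C) F'"
              using s' un rd Nil Cons by (simp add: step_tail_def run_emit unread_def clause_codes_def)
            ultimately have "step_inv n w (us @ [t]) ts (run step_tail s')"
              using s' un rd(1) Nil Cons wr ts unfolding step_inv_def
              by (auto simp: step_tail_def run_emit num_literals_append t)
            with cb show ?thesis ..
          next
            case F: Nil
            then have ts: "ts = []" using RF Nil by (simp add: tokens_simps)
            have "cbound U step_tail s'"
              using s' len un Nil F U''
              by (simp add: step_tail_def cbound_emit run_emit)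
            moreover have "step_inv n w (us @ [t]) ts (run step_tail s')"
              using s' un Nil F wr ts unfolding step_inv_def
              by (auto simp: step_tail_def run_emit num_literals_append t)
            ultimately show ?thesis ..
          qed
        qed
        then show "cbound U step_tail s'" "step_inv n w (us @ [t]) ts (run step_tail s')" by auto
      qed
    qed
  qed
  show ?thesis
    unfolding step_body_def
    by (rule achieves_mono[OF pre]) (simp_all add: algebra_simps)
qed

section \<open>Assembling the instance\<close>

definition setup_com :: com where
  "setup_com = block
     [Set_Var 2 (Cell 0 (N 0)), Set_Var 3 (Add (Add (Var 2) (Var 2)) (N 4)), Set_Var 4 (Cell 0 (N 1)),
      Set_Var 5 (N 2), Set_Var 9 (N 2), Set_Var 10 (N 1)]"

definition dipole_body :: com where
  "dipole_body = block [emit (Add (Var 6) (N 1)) (Add (Var 6) (N 2)), Set_Var 11 (Sub (Var 11) (N 1))]"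

text \<open>The first two cells were reserved as zeros because the number of edges is known only
  now: it is half the number of cells written after them. The increment by 3 counts vertex 0 and the
  two ends of the parallel edges.\<close>

definition header_com :: com where
  "header_com = block
     [Set_Var 14 (Div (Sub (Var 9) (N 2)) (N 2)), Set_Var 6 (Add (Var 6) (N 3)),
      Store 20 (N 0) (Var 6), Store 20 (N 1) (Var 14), Set_Var 11 (N 0)]"

definition order_body :: com where
  "order_body = block
     [Store 20 (Var 9) (Var 11), Set_Var 9 (Add (Var 9) (N 1)), Set_Var 11 (Add (Var 11) (N 1))]"

definition reduction :: com where
  "reduction = Seq setup_com (Seq (While (Var 10) step_body)
     (Seq (Seq (Set_Var 6 (Add (Var 6) (Var 3))) (Set_Var 11 (Add (Var 2) (N 5))))
       (Seq (While (Var 11) dipole_body) (Seq header_com (While (Sub (Var 6) (Var 11)) order_body)))))"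

lemma arr_upd: "i < length w \<Longrightarrow> (arr w)(i := x) = arr (w[i := x])"
  by (rule ext) (auto simp: arr_def)

lemma dipole_loop:
  assumes "written s w" "s 6 0 = a" "s 11 0 = k" and U: "length w + 2 * k \<le> U" "a + k + 2 \<le> U"
  shows "achieves (While (Var 11) dipole_body) s ((k + 1) * (60 * bit_len U))
     (\<lambda>s'. written s' (w @ flat (replicate k (a + 1, a + 2))) \<and> (\<forall>b. b \<notin> {9, 11, 20} \<longrightarrow> s' b = s b))"
proof -
  define I where "I i s' \<longleftrightarrow> i \<le> k \<and> written s' (w @ flat (replicate (k - i) (a + 1, a + 2))) \<and>
     s' 11 0 = i \<and> (\<forall>b. b \<notin> {9, 11, 20} \<longrightarrow> s' b = s b)" for i s'
  have "achieves (While (Var 11) dipole_body) s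
      (k * (1 + 2 * bit_len U + 50 * bit_len U) + (1 + 2 * bit_len U)) (I 0)"
  proof (rule achieves_While)
    show "I k s" using assms by (simp add: I_def)
    show "(aval (Var 11) s' = 0 \<longleftrightarrow> i = 0) \<and> acost (Var 11) s' \<le> 2 * bit_len U" if "I i s'" for i s'
      using that U acost_le[of U "Var 11" s'] by (auto simp: I_def)
  next
    fix i s' assume I: "I (Suc i) s'"
    then obtain j where j: "k = Suc i + j" unfolding I_def by (metis add.commute le_iff_add)
    have s': "written s' (w @ flat (replicate j (a + 1, a + 2)))" "s' 11 0 = Suc i" "s' 6 0 = a"
      "s' 9 0 = length w + 2 * j" "\<forall>b. b \<notin> {9, 11, 20} \<longrightarrow> s' b = s b"
      using I assms j by (auto simp: I_def dest: written_9)
    show "achieves dipole_body s' (50 * bit_len U) (I i)"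
    proof (rule achieves_run[where U = U])
      show "cbound U dipole_body s'"
        using s'(2-4) U j by (simp add: dipole_body_def cbound_emit run_emit)
      have "written (run dipole_body s') (w @ flat (replicate j (a + 1, a + 2)) @ [a + 1, a + 2])"
        using written_push[OF s'(1)] s'(2-4) by (simp add: dipole_body_def run_emit)
      moreover have "flat (replicate j (a + 1, a + 2)) @ [a + 1, a + 2] = flat (replicate (Suc j) (a + 1, a + 2))"
        by (induction j) auto
      ultimately have "written (run dipole_body s') (w @ flat (replicate (Suc j) (a + 1, a + 2)))" by metis
      then show "I i (run dipole_body s')"
        using s'(2-5) j by (simp add: I_def dipole_body_def run_emit)
      show "csize dipole_body * bit_len U \<le> 50 * bit_len U"
        by (simp add: dipole_body_def emit_def)
    qed
  qed
  then show ?thesis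
  proof (rule achieves_mono)
    have "1 + 2 * bit_len U + 50 * bit_len U \<le> 60 * bit_len U" "1 + 2 * bit_len U \<le> 60 * bit_len U"
      using bit_len_pos[of U] by auto
    then show "k * (1 + 2 * bit_len U + 50 * bit_len U) + (1 + 2 * bit_len U) \<le> (k + 1) * (60 * bit_len U)"
      by (metis add_mono add_mult_distrib mult.left_neutral mult_le_mono2)
  qed (auto simp: I_def)
qed

lemma order_loop:
  assumes "written s w" "s 6 0 = m" "s 11 0 = 0" and U: "length w + m + 1 \<le> U"
  shows "achieves (While (Sub (Var 6) (Var 11)) order_body) s ((m + 1) * (60 * bit_len U))
     (\<lambda>s'. written s' (w @ [0..<m]) \<and> (\<forall>b. b \<notin> {9, 11, 20} \<longrightarrow> s' b = s b))"
proof -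
  define I where "I i s' \<longleftrightarrow> i \<le> m \<and> written s' (w @ [0..<m - i]) \<and>
     s' 11 0 = m - i \<and> (\<forall>b. b \<notin> {9, 11, 20} \<longrightarrow> s' b = s b)" for i s'
  have "achieves (While (Sub (Var 6) (Var 11)) order_body) s
      (m * (1 + 5 * bit_len U + 50 * bit_len U) + (1 + 5 * bit_len U)) (I 0)"
  proof (rule achieves_While)
    show "I m s" using assms by (simp add: I_def)
    show "(aval (Sub (Var 6) (Var 11)) s' = 0 \<longleftrightarrow> i = 0) \<and> acost (Sub (Var 6) (Var 11)) s' \<le> 5 * bit_len U"
      if I: "I i s'" for i s'
    proof -
      have "acost (Sub (Var 6) (Var 11)) s' \<le> asize (Sub (Var 6) (Var 11)) * bit_len U"
        using I U assms(2) by (intro acost_le) (auto simp: I_def)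
      then show ?thesis using I assms(2) by (auto simp: I_def simp del: acost.simps)
    qed
  next
    fix i s' assume I: "I (Suc i) s'"
    then obtain j where j: "m = Suc i + j" unfolding I_def by (metis add.commute le_iff_add)
    have s': "written s' (w @ [0..<j])" "s' 11 0 = j" "s' 20 = arr (w @ [0..<j])"
      "s' 9 0 = length w + j" "\<forall>b. b \<notin> {9, 11, 20} \<longrightarrow> s' b = s b"
      using I assms j by (auto simp: I_def written_def)
    have "written (run order_body s') (w @ [0..<Suc j])"
      using s'(2-4) arr_snoc[of "w @ [0..<j]" j] by (simp add: order_body_def written_def)
    then show "achieves order_body s' (50 * bit_len U) (I i)"
      using s'(2-5) j U by (intro achieves_run[where U = U]) (simp_all add: I_def order_body_def)
  qed
  then show ?thesis
  proof (rule achieves_mono)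
    have "1 + 5 * bit_len U + 50 * bit_len U \<le> 60 * bit_len U" "1 + 5 * bit_len U \<le> 60 * bit_len U"
      using bit_len_pos[of U] by auto
    then show "m * (1 + 5 * bit_len U + 50 * bit_len U) + (1 + 5 * bit_len U) \<le> (m + 1) * (60 * bit_len U)"
      by (metis add_mono add_mult_distrib mult.left_neutral mult_le_mono2)
  qed (auto simp: I_def)
qed

lemma encode_instance_eq: "encode_instance m es vs = [m, length es] @ flat es @ vs"
  by (simp add: encode_instance_def flat_def)

lemma main_loop:
  assumes inv: "step_inv n w [] ts s" and "\<forall>c. Some c \<in> set ts \<longrightarrow> c < 2 * n"
    and U: "(length ts + 1) * (6 * n + 20) \<le> U" "length w \<le> length ts + 1"
  shows "achieves (While (Var 10) step_body) s ((length ts + 1) * ((n + 3) * (403 * bit_len U))) (step_inv n w ts [])"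
proof -
  let ?I = "\<lambda>k s'. \<exists>us vs. ts = us @ vs \<and> length vs = k \<and> step_inv n w us vs s'"
  have "achieves (While (Var 10) step_body) s
     (length ts * (1 + 2 * bit_len U + (n + 3) * (400 * bit_len U)) + (1 + 2 * bit_len U)) (?I 0)"
  proof (rule achieves_While)
    show "?I (length ts) s" using inv by (intro exI[of _ "[]"] exI[of _ ts]) simp
  next
    fix k s' assume "?I k s'"
    then obtain us vs where "length vs = k" "step_inv n w us vs s'" by blast
    then have z: "s' 10 0 = (if k = 0 then 0 else 1)" by (auto simp: step_inv_def)
    have "1 \<le> U" using U by simp
    then show "(aval (Var 10) s' = 0 \<longleftrightarrow> k = 0) \<and> acost (Var 10) s' \<le> 2 * bit_len U"
      using z acost_le[of U "Var 10" s'] by auto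
  next
    fix k s' assume "?I (Suc k) s'"
    then obtain us t vs where ts: "ts = us @ t # vs" "length vs = k" and inv': "step_inv n w us (t # vs) s'"
      by (metis length_Suc_conv)
    have "achieves step_body s' ((n + 3) * (400 * bit_len U)) (step_inv n w (us @ [t]) vs)"
      using inv' by (rule step_correct) (use assms ts in auto)
    then show "achieves step_body s' ((n + 3) * (400 * bit_len U)) (?I k)"
    proof (rule achieves_mono)
      show "?I k s''" if "step_inv n w (us @ [t]) vs s''" for s''
        using that ts by (intro exI[of _ "us @ [t]"] exI[of _ vs]) simp
    qed simp
  qed
  then show ?thesis
  proof (rule achieves_mono)
    have "1 + 2 * bit_len U + (n + 3) * (400 * bit_len U) \<le> (n + 3) * (403 * bit_len U)"
      "1 + 2 * bit_len U \<le> (n + 3) * (403 * bit_len U)"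
      using bit_len_pos[of U] by (auto simp: algebra_simps)
    then show "length ts * (1 + 2 * bit_len U + (n + 3) * (400 * bit_len U)) + (1 + 2 * bit_len U) \<le>
        (length ts + 1) * ((n + 3) * (403 * bit_len U))"
      by (metis add_mono add_mult_distrib mult.left_neutral mult_le_mono2)
  qed auto
qed

lemma reduction_correct:
  assumes F: "is_kcnf k n F"
  defines "ts \<equiv> tokens F"
  defines "m \<equiv> ising_order n ts" and "es \<equiv> ising_edges n ts" and "U \<equiv> (length ts + 2) * (6 * n + 20)"
  shows "m + length es + num_literals ts + 1 \<le> U"
    and "achieves reduction (init_memory (encode_cnf n F)) (1000 * U * bit_len U)
       (\<lambda>s. s 20 = arr (encode_instance m es [0..<m]) \<and> (\<forall>b>20. s b = (\<lambda>_. 0)) \<and>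
          s 6 0 = m \<and> s 8 0 = num_literals ts \<and> s 14 0 = length es)"
proof -
  let ?L = "length ts" and ?w = "encode_cnf n F"
  let ?steps = "steps_edges n 0 ts" and ?a = "?L * (2 * n + 4)"
  have codes: "\<forall>c. Some c \<in> set ts \<longrightarrow> c < 2 * n" using tokens_less[OF F] by (simp add: ts_def)
  have lenw: "length ?w = ?L + 1" by (simp add: encode_cnf_eq ts_def length_tokens)
  \<comment> \<open>Naming the only nonlinear product leaves linear arithmetic for most size
    estimates.\<close>
  define x where "x = ?L * (2 * n + 6)"
  have U: "U = 3 * x + 2 * ?L + 12 * n + 40" "m = x - 2 * ?L + 2 * n + 7" "?a = x - 2 * ?L" "2 * ?L \<le> x" "?L * 2 * n \<le> x"
    by (simp_all add: U_def m_def ising_order_def x_def algebra_simps)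
  have es: "es = ?steps @ replicate (n + 5) (?a + (2 * n + 4) + 1, ?a + (2 * n + 4) + 2)"
    by (simp add: es_def ising_edges_def)
  have steps: "length ?steps \<le> x" using length_steps_edges unfolding x_def .
  have nl: "num_literals us \<le> length us" for us by (induction us) auto
  show "m + length es + num_literals ts + 1 \<le> U"
    using steps nl[of ts] U es by simp
  have FL: "length F \<le> ?L" unfolding ts_def by (induction F) (auto simp: tokens_simps)
  let ?s = "init_memory ?w"
  define Q where "Q s \<longleftrightarrow> s 20 = arr (encode_instance m es [0..<m]) \<and> (\<forall>b>20. s b = (\<lambda>_. 0)) \<and>
          s 6 0 = m \<and> s 8 0 = num_literals ts \<and> s 14 0 = length es" for s :: memory
  have "achieves reduction ?s (50 * bit_len U + ((?L + 1) * ((n + 3) * (403 * bit_len U)) +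
      (50 * bit_len U + ((n + 5 + 1) * (60 * bit_len U) + (50 * bit_len U + (m + 1) * (60 * bit_len U)))))) Q"
    unfolding reduction_def
  proof (rule achieves_Seq)
    show "achieves setup_com ?s (50 * bit_len U) (step_inv n ?w [] ts)"
    proof (rule achieves_run[where U = U])
      have w: "arr ?w 0 = n" "arr ?w (Suc 0) = length F" by (auto simp: arr_def encode_cnf_eq)
      show "cbound U setup_com ?s"
        using w U FL by (simp add: setup_com_def)
      have "written (run setup_com ?s) [0, 0]"
        by (auto simp: setup_com_def written_def arr_def fun_eq_iff less_Suc_eq nth_Cons split: nat.split)
      moreover have "ts \<noteq> []" unfolding ts_def by (cases F) (auto simp: tokens_simps)
      moreover have "unread (run setup_com ?s) ?w [] F"
        using w by (auto simp: unread_def setup_com_def encode_cnf_eq)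
      ultimately show "step_inv n ?w [] ts (run setup_com ?s)"
        using w by (auto simp: step_inv_def setup_com_def ts_def)
    qed (simp add: setup_com_def)
  next
    fix s assume "step_inv n ?w [] ts s"
    then have "achieves (While (Var 10) step_body) s ((?L + 1) * ((n + 3) * (403 * bit_len U))) (step_inv n ?w ts [])"
      using codes by (rule main_loop) (simp_all add: U_def lenw)
    then show "achieves (Seq (While (Var 10) step_body)
       (Seq (Seq (Set_Var 6 (Add (Var 6) (Var 3))) (Set_Var 11 (Add (Var 2) (N 5))))
       (Seq (While (Var 11) dipole_body) (Seq header_com (While (Sub (Var 6) (Var 11)) order_body))))) s
       ((?L + 1) * ((n + 3) * (403 * bit_len U)) +
      (50 * bit_len U + ((n + 5 + 1) * (60 * bit_len U) + (50 * bit_len U + (m + 1) * (60 * bit_len U))))) Q"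
    proof (rule achieves_Seq)
      fix s assume "step_inv n ?w ts [] s"
      then have s: "s 2 0 = n" "s 3 0 = 2 * n + 4" "s 6 0 = ?a" "s 8 0 = num_literals ts"
          "written s ([0, 0] @ flat ?steps)" "\<forall>b>20. s b = (\<lambda>_. 0)"
        by (auto simp: step_inv_def)
      let ?s1 = "s(6 := (s 6)(0 := ?a + (2 * n + 4)), 11 := (s 11)(0 := n + 5))"
      have "achieves (Seq (Set_Var 6 (Add (Var 6) (Var 3))) (Set_Var 11 (Add (Var 2) (N 5)))) s
         (50 * bit_len U) (\<lambda>s'. s' = ?s1)"
        using s(1-4) U by (intro achieves_run[where U = U]) auto
      then show "achieves (Seq (Seq (Set_Var 6 (Add (Var 6) (Var 3))) (Set_Var 11 (Add (Var 2) (N 5))))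
         (Seq (While (Var 11) dipole_body) (Seq header_com (While (Sub (Var 6) (Var 11)) order_body)))) s
         (50 * bit_len U + ((n + 5 + 1) * (60 * bit_len U) + (50 * bit_len U + (m + 1) * (60 * bit_len U)))) Q"
      proof (rule achieves_Seq)
        fix s' assume s'_eq: "s' = ?s1"
        have "achieves (While (Var 11) dipole_body) ?s1 ((n + 5 + 1) * (60 * bit_len U))
          (\<lambda>s'. written s' (([0, 0] @ flat ?steps) @ flat (replicate (n + 5) (?a + (2 * n + 4) + 1, ?a + (2 * n + 4) + 2))) \<and>
            (\<forall>b. b \<notin> {9, 11, 20} \<longrightarrow> s' b = ?s1 b))"
          using s steps U by (intro dipole_loop) auto
        then show "achieves (Seq (While (Var 11) dipole_body) (Seq header_com (While (Sub (Var 6) (Var 11)) order_body))) s'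
            ((n + 5 + 1) * (60 * bit_len U) + (50 * bit_len U + (m + 1) * (60 * bit_len U))) Q"
          unfolding s'_eq
        proof (rule achieves_Seq)
          fix s' assume "written s' (([0, 0] @ flat ?steps) @ flat (replicate (n + 5) (?a + (2 * n + 4) + 1, ?a + (2 * n + 4) + 2))) \<and>
            (\<forall>b. b \<notin> {9, 11, 20} \<longrightarrow> s' b = ?s1 b)"
          then have wr: "written s' ([0, 0] @ flat es)" and s': "s' 6 0 = ?a + (2 * n + 4)"
              "s' 8 0 = num_literals ts" "\<forall>b>20. s' b = (\<lambda>_. 0)"
            using s by (auto simp: es)
          have len: "s' 9 0 = 2 + 2 * length es" using written_9[OF wr] by simp
          have mU: "m + 2 * length es + 3 \<le> U" "?a + 2 * n + 7 = m" using steps U es by auto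
          let ?h = "[m, length es] @ flat es"
          have "achieves header_com s' (50 * bit_len U) (\<lambda>s. written s ?h \<and> s 6 0 = m \<and> s 11 0 = 0 \<and>
             s 8 0 = num_literals ts \<and> s 14 0 = length es \<and> (\<forall>b>20. s b = (\<lambda>_. 0)))"
          proof (rule achieves_run[where U = U])
            show "cbound U header_com s'"
              using s' len mU by (simp add: header_com_def)
            have "((arr ([0, 0] @ flat es))(0 := m))(1 := length es) = arr ?h"
              by (simp add: arr_upd)
            then show "written (run header_com s') ?h \<and> run header_com s' 6 0 = m \<and> run header_com s' 11 0 = 0 \<and>
               run header_com s' 8 0 = num_literals ts \<and> run header_com s' 14 0 = length es \<and>
               (\<forall>b>20. run header_com s' b = (\<lambda>_. 0))"
              using s' len wr mU by (simp add: header_com_def written_def add_ac)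
          qed (simp add: header_com_def)
          then show "achieves (Seq header_com (While (Sub (Var 6) (Var 11)) order_body)) s'
            (50 * bit_len U + (m + 1) * (60 * bit_len U)) Q"
          proof (rule achieves_Seq)
            fix s'' assume s'': "written s'' ?h \<and> s'' 6 0 = m \<and> s'' 11 0 = 0 \<and>
             s'' 8 0 = num_literals ts \<and> s'' 14 0 = length es \<and> (\<forall>b>20. s'' b = (\<lambda>_. 0))"
            have "achieves (While (Sub (Var 6) (Var 11)) order_body) s'' ((m + 1) * (60 * bit_len U))
              (\<lambda>s'. written s' (?h @ [0..<m]) \<and> (\<forall>b. b \<notin> {9, 11, 20} \<longrightarrow> s' b = s'' b))"
              using s'' mU by (intro order_loop) auto
            then show "achieves (While (Sub (Var 6) (Var 11)) order_body) s'' ((m + 1) * (60 * bit_len U)) Q"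
              by (rule achieves_mono) (use s'' in \<open>auto simp: Q_def encode_instance_eq written_def\<close>)
          qed
        qed
      qed
    qed
  qed
  then show "achieves reduction ?s (1000 * U * bit_len U) (\<lambda>s. s 20 = arr (encode_instance m es [0..<m]) \<and>
      (\<forall>b>20. s b = (\<lambda>_. 0)) \<and> s 6 0 = m \<and> s 8 0 = num_literals ts \<and> s 14 0 = length es)"
    unfolding Q_def
  proof (rule achieves_mono)
    define y where "y = (?L + 1) * (n + 3)"
    have "y \<le> U" unfolding U_def y_def by (intro mult_le_mono) auto
    then have "50 + (y * 403 + (50 + ((n + 5 + 1) * 60 + (50 + (m + 1) * 60)))) \<le> 1000 * U"
    proof -
      have "m \<le> x + 2 * n + 7" "3 * x + 12 * n + 40 \<le> U" using U(1,2) by simp_all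
      then show ?thesis using \<open>y \<le> U\<close> by (simp add: algebra_simps)
    qed
    then have "(50 + (y * 403 + (50 + ((n + 5 + 1) * 60 + (50 + (m + 1) * 60))))) * bit_len U \<le>
        1000 * U * bit_len U" by (rule mult_le_mono1)
    then show "50 * bit_len U + ((?L + 1) * ((n + 3) * (403 * bit_len U)) +
      (50 * bit_len U + ((n + 5 + 1) * (60 * bit_len U) + (50 * bit_len U + (m + 1) * (60 * bit_len U)))))
      \<le> 1000 * U * bit_len U" by (simp add: algebra_simps y_def)
  qed
qed

section \<open>Evaluating the Tutte polynomial\<close>

definition power_body :: "nat \<Rightarrow> aexp \<Rightarrow> com" where
  "power_body r e = block [Set_Var r (Mul (Var r) e), Set_Var 11 (Sub (Var 11) (N 1))]"

text \<open>The expression may be a constant or a variable: the lemma serves both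
  \<open>3 ^ m\<close> and the power of this number stored in variable 15.\<close>

lemma power_loop:
  assumes r: "r \<noteq> 11" "s r 0 = 1" and k: "s 11 0 = k" "k + 1 \<le> U"
    and e: "\<And>s'. (\<forall>b. b \<notin> {r, 11} \<longrightarrow> s' b = s b) \<Longrightarrow> aval e s' = c \<and> abound U e s'" "asize e \<le> 2"
    and c: "1 \<le> c" "c ^ k \<le> U"
  shows "achieves (While (Var 11) (power_body r e)) s ((k + 1) * (40 * bit_len U))
     (\<lambda>s'. s' r 0 = c ^ k \<and> (\<forall>b. b \<notin> {r, 11} \<longrightarrow> s' b = s b))"
proof -
  define I where "I i s' \<longleftrightarrow> i \<le> k \<and> s' r 0 = c ^ (k - i) \<and> s' 11 0 = i \<and>
     (\<forall>b. b \<notin> {r, 11} \<longrightarrow> s' b = s b)" for i s'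
  have "achieves (While (Var 11) (power_body r e)) s
      (k * (1 + 2 * bit_len U + 30 * bit_len U) + (1 + 2 * bit_len U)) (I 0)"
  proof (rule achieves_While)
    show "I k s" using assms by (simp add: I_def)
    show "(aval (Var 11) s' = 0 \<longleftrightarrow> i = 0) \<and> acost (Var 11) s' \<le> 2 * bit_len U" if "I i s'" for i s'
      using that k acost_le[of U "Var 11" s'] by (auto simp: I_def)
  next
    fix i s' assume I: "I (Suc i) s'"
    then obtain j where j: "k = Suc i + j" unfolding I_def by (metis add.commute le_iff_add)
    have s': "s' r 0 = c ^ j" "s' 11 0 = Suc i" "\<forall>b. b \<notin> {r, 11} \<longrightarrow> s' b = s b"
      using I j by (auto simp: I_def)
    note ev = e(1)[OF s'(3)]
    have pw: "c ^ j \<le> U" "c ^ j * c \<le> U"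
      using power_increasing[of j k c, OF _ c(1)] power_increasing[of "Suc j" k c, OF _ c(1)] c(2) j
      by (simp_all add: mult.commute order_trans del: power_Suc flip: power_Suc)
    show "achieves (power_body r e) s' (30 * bit_len U) (I i)"
    proof (rule achieves_run[where U = U])
      show "cbound U (power_body r e) s'"
        using s' ev pw j k r by (simp add: power_body_def)
      show "I i (run (power_body r e) s')"
        using s' ev r j by (simp add: I_def power_body_def)
      show "csize (power_body r e) * bit_len U \<le> 30 * bit_len U"
        using e(2) by (simp add: power_body_def)
    qed
  qed
  then show ?thesis
  proof (rule achieves_mono)
    have "1 + 2 * bit_len U + 30 * bit_len U \<le> 40 * bit_len U" "1 + 2 * bit_len U \<le> 40 * bit_len U"
      using bit_len_pos[of U] by auto
    then show "k * (1 + 2 * bit_len U + 30 * bit_len U) + (1 + 2 * bit_len U) \<le> (k + 1) * (40 * bit_len U)"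
      by (metis add_mono add_mult_distrib mult.left_neutral mult_le_mono2)
  qed (auto simp: I_def)
qed

definition horner_body :: com where
  "horner_body = block
     [Set_Var 11 (Sub (Var 11) (N 1)), Set_Var 17 (Add (Mul (Var 17) (Var 18)) (Cell 21 (Var 11)))]"

text \<open>Horner's rule from the leading coefficient down. After \<open>k\<close> rounds the
  partial value is at most \<open>B * q ^ k\<close>, since multiplying by q - 1 leaves room for one
  more coefficient; so no intermediate result exceeds \<open>U\<close>.\<close>

lemma horner_loop:
  assumes s: "s 17 0 = 0" "s 18 0 = q - 1" "s 11 0 = T" "s 21 = out"
    and out: "\<forall>j<T. out j \<le> B" and q: "1 \<le> q" and U: "B * q ^ T \<le> U" "T + q + 1 \<le> U"
  shows "achieves (While (Var 11) horner_body) s ((T + 1) * (40 * bit_len U))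
     (\<lambda>s'. s' 17 0 = (\<Sum>j<T. out j * (q - 1) ^ j) \<and> s' 17 0 \<le> U \<and> (\<forall>b. b \<notin> {11, 17} \<longrightarrow> s' b = s b))"
proof -
  define I where "I i s' \<longleftrightarrow> i \<le> T \<and> s' 17 0 = (\<Sum>j<T - i. out (i + j) * (q - 1) ^ j) \<and> s' 17 0 \<le> B * q ^ (T - i) \<and>
     s' 11 0 = i \<and> (\<forall>b. b \<notin> {11, 17} \<longrightarrow> s' b = s b)" for i s'
  have pw: "B * q ^ j \<le> U" if "j \<le> T" for j
    using power_increasing[OF that q] U(1) by (meson mult_le_mono2 le_trans)
  have "achieves (While (Var 11) horner_body) s
      (T * (1 + 2 * bit_len U + 30 * bit_len U) + (1 + 2 * bit_len U)) (I 0)"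
  proof (rule achieves_While)
    show "I T s" using assms by (simp add: I_def)
    show "(aval (Var 11) s' = 0 \<longleftrightarrow> i = 0) \<and> acost (Var 11) s' \<le> 2 * bit_len U" if "I i s'" for i s'
      using that U acost_le[of U "Var 11" s'] by (auto simp: I_def)
  next
    fix i s' assume I: "I (Suc i) s'"
    then obtain k where k: "T = Suc i + k" unfolding I_def by (metis add.commute le_iff_add)
    let ?P = "\<Sum>j<k. out (Suc i + j) * (q - 1) ^ j"
    have s': "s' 17 0 = ?P" "?P \<le> B * q ^ k" "s' 11 0 = Suc i" "s' 18 0 = q - 1" "s' 21 = out"
       "\<forall>b. b \<notin> {11, 17} \<longrightarrow> s' b = s b"
      using I s k by (auto simp: I_def)
    have oi: "out i \<le> B" using out k by simp
    have eq: "?P * (q - 1) + out i = (\<Sum>j<Suc k. out (i + j) * (q - 1) ^ j)"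
      by (subst sum.lessThan_Suc_shift) (simp add: sum_distrib_left mult_ac)
    have "?P * (q - 1) + out i \<le> B * q ^ k * (q - 1) + B * q ^ k"
      using s'(2) oi q by (intro add_mono mult_le_mono1) (auto intro: order_trans)
    also have "\<dots> = B * q ^ Suc k" using q by (cases q) (auto simp: algebra_simps)
    finally have le: "?P * (q - 1) + out i \<le> B * q ^ Suc k" .
    have leU: "?P * (q - 1) + out i \<le> U" "?P \<le> U" "?P * (q - 1) \<le> U" "out i \<le> U"
      using le s'(2) pw[of "Suc k"] pw[of k] k by auto
    show "achieves horner_body s' (30 * bit_len U) (I i)"
    proof (rule achieves_run[where U = U])
      show "cbound U horner_body s'"
        using s'(1,3-5) leU U k by (simp add: horner_body_def)
      have "run horner_body s' 17 0 = ?P * (q - 1) + out i"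
        using s'(1,3-5) by (simp add: horner_body_def)
      moreover have "run horner_body s' 11 0 = i" "\<forall>b. b \<notin> {11, 17} \<longrightarrow> run horner_body s' b = s b"
        using s'(3-6) by (auto simp: horner_body_def)
      moreover have "T - i = Suc k" using k by simp
      ultimately show "I i (run horner_body s')"
        using le k unfolding I_def eq by simp
      show "csize horner_body * bit_len U \<le> 30 * bit_len U"
        by (simp add: horner_body_def)
    qed
  qed
  then show ?thesis
  proof (rule achieves_mono)
    have "1 + 2 * bit_len U + 30 * bit_len U \<le> 40 * bit_len U" "1 + 2 * bit_len U \<le> 40 * bit_len U"
      using bit_len_pos[of U] by auto
    then show "T * (1 + 2 * bit_len U + 30 * bit_len U) + (1 + 2 * bit_len U) \<le> (T + 1) * (40 * bit_len U)"
      by (metis add_mono add_mult_distrib mult.left_neutral mult_le_mono2)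
  qed (use pw[of T] in \<open>auto simp: I_def\<close>)
qed

text \<open>Variable 15 receives q, 16 the power of q to be tested, 17 the value of the polynomial
  and 18 the point q - 1. The remainder left in array 1 is nonzero exactly when divisibility fails.
  Array 21 is the output array 1 of the moved program.\<close>

definition decode :: com where
  "decode = Seq (Seq (Set_Var 15 (N 1)) (Set_Var 11 (Var 6))) (Seq (While (Var 11) (power_body 15 (N 3)))
     (Seq (Seq (Set_Var 16 (N 1)) (Set_Var 11 (Add (Var 8) (N 1)))) (Seq (While (Var 11) (power_body 16 (Var 15)))
       (Seq (Seq (Set_Var 17 (N 0)) (Seq (Set_Var 18 (Sub (Var 15) (N 1)))
              (Set_Var 11 (Add (Add (Var 6) (Var 14)) (N 1)))))
         (Seq (While (Var 11) horner_body)
           (Set_Var 1 (Sub (Var 17) (Mul (Div (Var 17) (Var 16)) (Var 16)))))))))"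

lemma decode_correct:
  assumes s: "s 6 0 = m" "s 8 0 = l" "s 14 0 = M" "s 21 = out"
    and out: "\<forall>j \<le> m + M. out j \<le> B"
    and U: "B * (3 ^ m) ^ (m + M + 1) \<le> U" "(3 ^ m) ^ (l + 1) \<le> U" "m + M + l + 3 ^ m + 4 \<le> U"
  shows "achieves decode s ((2 * m + M + l + 20) * (40 * bit_len U))
    (\<lambda>s'. s' 1 0 = (\<Sum>j \<le> m + M. out j * (3 ^ m - 1) ^ j) mod (3 ^ m) ^ (l + 1))"
proof -
  let ?q = "3 ^ m :: nat" and ?P = "\<Sum>j \<le> m + M. out j * (3 ^ m - 1) ^ j"
  let ?b = "40 * bit_len U"
  have "achieves decode s (?b + ((m + 1) * ?b + (?b + ((l + 1 + 1) * ?b + (?b + ((m + M + 1 + 1) * ?b + ?b))))))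
     (\<lambda>s'. s' 1 0 = ?P mod ?q ^ (l + 1))"
    unfolding decode_def
  proof (rule achieves_Seq)
    let ?s1 = "s(15 := (s 15)(0 := 1), 11 := (s 11)(0 := m))"
    show "achieves (Seq (Set_Var 15 (N 1)) (Set_Var 11 (Var 6))) s ?b (\<lambda>s'. s' = ?s1)"
      using s U by (intro achieves_run[where U = U]) auto
    fix s' assume s': "s' = ?s1"
    have "achieves (While (Var 11) (power_body 15 (N 3))) ?s1 ((m + 1) * ?b)
       (\<lambda>s'. s' 15 0 = ?q \<and> (\<forall>b. b \<notin> {15, 11} \<longrightarrow> s' b = ?s1 b))"
      using U(3) by (intro power_loop) auto
    then show "achieves (Seq (While (Var 11) (power_body 15 (N 3)))
     (Seq (Seq (Set_Var 16 (N 1)) (Set_Var 11 (Add (Var 8) (N 1)))) (Seq (While (Var 11) (power_body 16 (Var 15)))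
       (Seq (Seq (Set_Var 17 (N 0)) (Seq (Set_Var 18 (Sub (Var 15) (N 1)))
              (Set_Var 11 (Add (Add (Var 6) (Var 14)) (N 1)))))
         (Seq (While (Var 11) horner_body)
           (Set_Var 1 (Sub (Var 17) (Mul (Div (Var 17) (Var 16)) (Var 16))))))))) s'
         ((m + 1) * ?b + (?b + ((l + 1 + 1) * ?b + (?b + ((m + M + 1 + 1) * ?b + ?b)))))
       (\<lambda>s'. s' 1 0 = ?P mod ?q ^ (l + 1))"
      unfolding s'
    proof (rule achieves_Seq)
      fix s2 assume "s2 15 0 = ?q \<and> (\<forall>b. b \<notin> {15, 11} \<longrightarrow> s2 b = ?s1 b)"
      then have s2: "s2 15 0 = ?q" "s2 6 0 = m" "s2 8 0 = l" "s2 14 0 = M" "s2 21 = out" using s by auto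
      let ?s3 = "s2(16 := (s2 16)(0 := 1), 11 := (s2 11)(0 := l + 1))"
      show "achieves (Seq (Seq (Set_Var 16 (N 1)) (Set_Var 11 (Add (Var 8) (N 1)))) (Seq (While (Var 11) (power_body 16 (Var 15)))
       (Seq (Seq (Set_Var 17 (N 0)) (Seq (Set_Var 18 (Sub (Var 15) (N 1)))
              (Set_Var 11 (Add (Add (Var 6) (Var 14)) (N 1)))))
         (Seq (While (Var 11) horner_body)
           (Set_Var 1 (Sub (Var 17) (Mul (Div (Var 17) (Var 16)) (Var 16)))))))) s2
         (?b + ((l + 1 + 1) * ?b + (?b + ((m + M + 1 + 1) * ?b + ?b))))
         (\<lambda>s'. s' 1 0 = ?P mod ?q ^ (l + 1))"
      proof (rule achieves_Seq)
        show "achieves (Seq (Set_Var 16 (N 1)) (Set_Var 11 (Add (Var 8) (N 1)))) s2 ?b (\<lambda>s'. s' = ?s3)"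
          using s2 U by (intro achieves_run[where U = U]) auto
        fix s' assume s': "s' = ?s3"
        have "achieves (While (Var 11) (power_body 16 (Var 15))) ?s3 ((l + 1 + 1) * ?b)
           (\<lambda>s'. s' 16 0 = ?q ^ (l + 1) \<and> (\<forall>b. b \<notin> {16, 11} \<longrightarrow> s' b = ?s3 b))"
          using s2 U(2,3) by (intro power_loop) auto
        then show "achieves (Seq (While (Var 11) (power_body 16 (Var 15)))
           (Seq (Seq (Set_Var 17 (N 0)) (Seq (Set_Var 18 (Sub (Var 15) (N 1)))
              (Set_Var 11 (Add (Add (Var 6) (Var 14)) (N 1)))))
         (Seq (While (Var 11) horner_body)
           (Set_Var 1 (Sub (Var 17) (Mul (Div (Var 17) (Var 16)) (Var 16))))))) s'
         ((l + 1 + 1) * ?b + (?b + ((m + M + 1 + 1) * ?b + ?b)))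
         (\<lambda>s'. s' 1 0 = ?P mod ?q ^ (l + 1))"
          unfolding s'
        proof (rule achieves_Seq)
          fix s4 assume "s4 16 0 = ?q ^ (l + 1) \<and> (\<forall>b. b \<notin> {16, 11} \<longrightarrow> s4 b = ?s3 b)"
          then have s4: "s4 16 0 = ?q ^ (l + 1)" "s4 15 0 = ?q" "s4 6 0 = m" "s4 14 0 = M" "s4 21 = out"
            using s2 by auto
          let ?s5 = "s4(17 := (s4 17)(0 := 0), 18 := (s4 18)(0 := ?q - 1), 11 := (s4 11)(0 := m + M + 1))"
          show "achieves (Seq (Seq (Set_Var 17 (N 0)) (Seq (Set_Var 18 (Sub (Var 15) (N 1)))
              (Set_Var 11 (Add (Add (Var 6) (Var 14)) (N 1)))))
            (Seq (While (Var 11) horner_body)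
             (Set_Var 1 (Sub (Var 17) (Mul (Div (Var 17) (Var 16)) (Var 16)))))) s4
            (?b + ((m + M + 1 + 1) * ?b + ?b)) (\<lambda>s'. s' 1 0 = ?P mod ?q ^ (l + 1))"
          proof (rule achieves_Seq)
            show "achieves (Seq (Set_Var 17 (N 0)) (Seq (Set_Var 18 (Sub (Var 15) (N 1)))
                (Set_Var 11 (Add (Add (Var 6) (Var 14)) (N 1))))) s4 ?b (\<lambda>s'. s' = ?s5)"
              using s4 U by (intro achieves_run[where U = U]) auto
            fix s' assume s': "s' = ?s5"
            have "achieves (While (Var 11) horner_body) ?s5 ((m + M + 1 + 1) * ?b)
              (\<lambda>s'. s' 17 0 = (\<Sum>j<m + M + 1. out j * (?q - 1) ^ j) \<and> s' 17 0 \<le> U \<and>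
                 (\<forall>b. b \<notin> {11, 17} \<longrightarrow> s' b = ?s5 b))"
              using s4 U out by (intro horner_loop[where B = B]) auto
            then show "achieves (Seq (While (Var 11) horner_body)
              (Set_Var 1 (Sub (Var 17) (Mul (Div (Var 17) (Var 16)) (Var 16))))) s'
              ((m + M + 1 + 1) * ?b + ?b) (\<lambda>s'. s' 1 0 = ?P mod ?q ^ (l + 1))"
              unfolding s'
            proof (rule achieves_Seq)
              fix s6 assume "s6 17 0 = (\<Sum>j<m + M + 1. out j * (?q - 1) ^ j) \<and> s6 17 0 \<le> U \<and>
                 (\<forall>b. b \<notin> {11, 17} \<longrightarrow> s6 b = ?s5 b)"
              then have s6: "s6 17 0 = ?P" "?P \<le> U" "s6 16 0 = ?q ^ (l + 1)"
                using s4 by (auto simp: lessThan_Suc_atMost)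
              have "?P div ?q ^ (l + 1) * ?q ^ (l + 1) \<le> U"
                using s6(2) div_times_less_eq_dividend[of ?P "?q ^ (l + 1)"] by linarith
              then show "achieves (Set_Var 1 (Sub (Var 17) (Mul (Div (Var 17) (Var 16)) (Var 16)))) s6 ?b
                (\<lambda>s'. s' 1 0 = ?P mod ?q ^ (l + 1))"
                using s6 U(2) by (intro achieves_run[where U = U]) (simp_all add: minus_div_mult_eq_mod del: power_Suc)
            qed
          qed
        qed
      qed
    qed
  qed
  then show ?thesis
  proof (rule achieves_mono)
    have "?b + ((m + 1) * ?b + (?b + ((l + 1 + 1) * ?b + (?b + ((m + M + 1 + 1) * ?b + ?b))))) =
       (1 + ((m + 1) + (1 + ((l + 1 + 1) + (1 + ((m + M + 1 + 1) + 1)))))) * ?b"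
      by (simp only: add_mult_distrib mult.left_neutral)
    also have "\<dots> \<le> (2 * m + M + l + 20) * ?b" by (intro mult_le_mono1) simp
    finally show "?b + ((m + 1) * ?b + (?b + ((l + 1 + 1) * ?b + (?b + ((m + M + 1 + 1) * ?b + ?b)))))
      \<le> (2 * m + M + l + 20) * ?b" .
  qed
qed

section \<open>The algorithm for k-SAT\<close>

text \<open>The offset 20 turns the input array 0 of \<open>p\<close> into the array in which the
  instance is collected, and it protects the variables that \<open>decode\<close> needs
  afterwards.\<close>

definition sat_via_ising :: "com \<Rightarrow> com" where
  "sat_via_ising p = Seq reduction (Seq (shift_com 20 p) decode)"

lemma fin_graph_ising:
  assumes "\<forall>c. Some c \<in> set ts \<longrightarrow> c < 2 * n"
  shows "fin_graph (graph_of (ising_order n ts) (ising_edges n ts))"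
  using ising_edges_bound[OF assms] unfolding fin_graph_def graph_of_def
  by (auto intro!: bexI) (metis nth_mem prod.collapse less_trans)+

text \<open>As all arrays above 20 are still zero, the moved program finds precisely its initial
  memory.\<close>

lemma achieves_shift:
  assumes p: "exec p (init_memory w) t s'" and s: "s 20 = arr w" "\<forall>b>20. s b = (\<lambda>_. 0)" and "t \<le> T"
  shows "achieves (shift_com 20 p) s T (\<lambda>s''. (\<forall>b<20. s'' b = s b) \<and> s'' 21 = s' 1)"
proof -
  have "s = (\<lambda>a. if a < 20 then s a else init_memory w (a - 20))"
  proof
    fix a show "s a = (if a < 20 then s a else init_memory w (a - 20))"
      using s by (cases a "20 :: nat" rule: linorder_cases) auto
  qed
  then have "exec (shift_com 20 p) s t (\<lambda>a. if a < 20 then s a else s' (a - 20))"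
    using exec_shift[OF p, of 20 s] by simp
  then show ?thesis using \<open>t \<le> T\<close> unfolding achieves_def by fastforce
qed

lemma sat_via_ising_correct:
  assumes p: "computes_tutte_curve_within 2 p T" and F: "is_kcnf k n F"
  defines "U \<equiv> (length (tokens F) + 2) * (6 * n + 20)" and "m \<equiv> ising_order n (tokens F)"
  shows "m \<le> U" and "outputs_within (sat_via_ising p) (encode_cnf n F) (7000 * real U ^ 3 + T m (n + 5))
    (\<lambda>out. out 0 \<noteq> 0 \<longleftrightarrow> satisfiable F)"
proof -
  let ?ts = "tokens F"
  define es where "es = ising_edges n ?ts"
  define l where "l = num_literals ?ts"
  define G where "G = graph_of m es"
  note bound = reduction_correct(1)[OF F, folded U_def m_def es_def l_def]
  note red = reduction_correct(2)[OF F, folded U_def m_def es_def l_def]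
  show "m \<le> U" using bound by simp
  have codes: "\<forall>c. Some c \<in> set ?ts \<longrightarrow> c < 2 * n" using tokens_less[OF F] by simp
  have G: "fin_graph G" unfolding G_def m_def es_def using codes by (rule fin_graph_ising)
  have card: "card (verts G) = m" "card (edges G) = length es" by (simp_all add: G_def graph_of_def)
  have inst: "is_instance m es [0..<m]" unfolding m_def es_def using codes by (rule is_instance_ising)
  have width: "cutwidth (graph_of m es) = n + 5" unfolding m_def es_def using cutwidth_ising(1)[OF codes] .
  obtain t s' where t: "exec p (init_memory (encode_instance m es [0..<m])) t s'" "real t \<le> T m (n + 5)"
    and out: "\<forall>j \<le> m + length es. real (s' 1 j) = fls_nth (tutte_curve 2 G) (int j - int m)"
    using p[unfolded computes_tutte_curve_within_def, rule_format, OF inst]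
    unfolding width outputs_within_def G_def by auto
  let ?q = "3 ^ m :: nat" and ?P = "\<Sum>j \<le> m + length es. s' 1 j * (3 ^ m - 1) ^ j"
  have "l \<le> card (monochromatic G X)" for X
    unfolding G_def card_monochromatic_graph_of l_def es_def by (rule mono_count_ising_ge)
  then have "?q ^ (l + 1) dvd ?P \<longleftrightarrow> (\<forall>X\<subseteq>verts G. card (monochromatic G X) \<noteq> l)"
    using tutte_divisibility_iff[OF G, of "s' 1" ?q l] out unfolding card
    by (simp add: power_strict_mono m_def ising_order_def)
  also have "\<dots> \<longleftrightarrow> \<not> (\<exists>X. mono_count X es = l)"
  proof -
    \<comment> \<open>Numbers outside the vertex set are ends of no edge, so arbitrary sets and sets
      of vertices attain the same counts.\<close>
    have "mono_count (X \<inter> verts G) es = mono_count X es" for X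
    proof -
      have "monochromatic G (X \<inter> verts G) = monochromatic G X"
        using G unfolding monochromatic_def fin_graph_def by fastforce
      then have "card (monochromatic G (X \<inter> verts G)) = card (monochromatic G X)" by simp
      then show ?thesis by (simp only: G_def card_monochromatic_graph_of)
    qed
    then show ?thesis unfolding G_def card_monochromatic_graph_of by (metis inf_le2)
  qed
  also have "\<dots> \<longleftrightarrow> \<not> satisfiable F"
    using satisfiable_iff_mono_count[OF F] by (simp add: es_def l_def)
  finally have sat: "?P mod ?q ^ (l + 1) \<noteq> 0 \<longleftrightarrow> satisfiable F" by (simp add: dvd_eq_mod_eq_0)
  \<comment> \<open>The exponent bounds all numbers in \<open>decode\<close>: coefficients are at
    most 2^U, and q is at most 4^m, so its powers up to U + 1 are at most 2^(2U(U+1)). About U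
    rounds on numbers of O(U^2) bits yield the cubic time bound.\<close>
  define e where "e = U + 2 * U * (U + 1)"
  let ?V = "2 ^ e :: nat"
  have q4: "?q \<le> 2 ^ (2 * m)" using power_mono[of 3 "4 :: nat" m] by (simp add: power_mult)
  have q: "?q ^ i \<le> 2 ^ (2 * U * (U + 1))" if "i \<le> U + 1" for i
  proof -
    have "?q ^ i \<le> (2 ^ (2 * m)) ^ i" using q4 by (rule power_mono) simp
    also have "\<dots> = 2 ^ (2 * m * i)" by (simp add: power_mult)
    also have "\<dots> \<le> 2 ^ (2 * U * (U + 1))"
      using that bound by (intro power_increasing mult_le_mono) auto
    finally show ?thesis .
  qed
  have dec: "achieves decode s ((2 * m + length es + l + 20) * (40 * bit_len ?V))
      (\<lambda>s. s 1 0 = ?P mod ?q ^ (l + 1))"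
    if "s 6 0 = m" "s 8 0 = l" "s 14 0 = length es" "s 21 = s' 1" for s
    using that
  proof (rule decode_correct)
    show "\<forall>j \<le> m + length es. s' 1 j \<le> 2 ^ (m + length es)"
      using tutte_coeff_le[OF G, of "s' 1"] out card by simp
    have "2 ^ (m + length es) * ?q ^ (m + length es + 1) \<le> 2 ^ U * 2 ^ (2 * U * (U + 1))"
      using bound by (intro mult_le_mono q power_increasing) auto
    then show "2 ^ (m + length es) * ?q ^ (m + length es + 1) \<le> ?V" by (simp only: e_def power_add)
    show "?q ^ (l + 1) \<le> ?V"
    proof -
      have "?q ^ (l + 1) \<le> 2 ^ (2 * U * (U + 1))" using bound by (intro q) simp
      also have "\<dots> \<le> ?V" by (intro power_increasing) (auto simp: e_def)
      finally show ?thesis .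
    qed
    have "(2::nat) ^ (2 * m) \<le> 2 ^ (2 * U)" using bound by (intro power_increasing) auto
    then have "m + length es + l + 3 ^ m + 4 \<le> U + 3 + 2 ^ (2 * U)" using bound q4 by linarith
    also have "U + 3 \<le> 2 ^ (U + 2)" using less_exp[of U] unfolding power_add power2_eq_square by linarith
    also have "2 ^ (U + 2) + 2 ^ (2 * U) \<le> 2 ^ (2 * U + 2) + (2 ^ (2 * U + 2) :: nat)"
      by (intro add_mono power_increasing) auto
    also have "\<dots> = 2 ^ (2 * U + 3)" by (simp add: power_add)
    also have "\<dots> \<le> ?V"
    proof (rule power_increasing)
      have "40 \<le> U" unfolding U_def by simp
      then show "2 * U + 3 \<le> e" unfolding e_def by simp
    qed simp
    finally show "m + length es + l + 3 ^ m + 4 \<le> ?V" by simp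
  qed
  let ?T1 = "1000 * U * bit_len U" and ?T3 = "(2 * m + length es + l + 20) * (40 * bit_len ?V)"
  have "achieves (sat_via_ising p) (init_memory (encode_cnf n F)) (?T1 + (t + ?T3))
     (\<lambda>s. s 1 0 = ?P mod ?q ^ (l + 1))"
    unfolding sat_via_ising_def using red
  proof (rule achieves_Seq)
    fix s :: memory assume s: "s 20 = arr (encode_instance m es [0..<m]) \<and> (\<forall>b>20. s b = (\<lambda>_. 0)) \<and>
          s 6 0 = m \<and> s 8 0 = l \<and> s 14 0 = length es"
    then have "achieves (shift_com 20 p) s t (\<lambda>s''. (\<forall>b<20. s'' b = s b) \<and> s'' 21 = s' 1)"
      by (intro achieves_shift[OF t(1)]) auto
    then show "achieves (Seq (shift_com 20 p) decode) s (t + ?T3) (\<lambda>s. s 1 0 = ?P mod ?q ^ (l + 1))"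
      by (rule achieves_Seq) (intro dec; use s in auto)
  qed
  moreover have "real (?T1 + (t + ?T3)) \<le> 7000 * real U ^ 3 + T m (n + 5)"
  proof -
    have U40: "40 \<le> U" unfolding U_def by simp
    have "bit_len U \<le> 2 * U" using bit_len_le[of U] U40 by simp
    then have "?T1 \<le> 1000 * U * (2 * U)" by (rule mult_le_mono2)
    also have "\<dots> \<le> 2000 * (U * U * U)" using U40 by simp
    finally have 1: "?T1 \<le> 2000 * U ^ 3" by (simp add: power3_eq_cube)
    have "bit_len ?V = e + 1" by (rule bit_len_power2)
    also have "\<dots> \<le> 3 * (U * U)"
    proof -
      have "40 * U \<le> U * U" using U40 by simp
      moreover have "e + 1 = 2 * (U * U) + 3 * U + 1" unfolding e_def by (simp add: algebra_simps)
      ultimately show ?thesis using U40 by linarith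
    qed
    finally have "?T3 \<le> (3 * U) * (40 * (3 * (U * U)))"
      using bound U40 by (intro mult_le_mono) auto
    then have "?T3 \<le> 5000 * U ^ 3" by (simp add: power3_eq_cube)
    from add_mono[OF 1 this] have "?T1 + ?T3 \<le> 7000 * U ^ 3" by (simp only: add_mult_distrib[symmetric]) simp
    then have "real (?T1 + ?T3) \<le> real (7000 * U ^ 3)" by (simp only: of_nat_le_iff)
    then show ?thesis using t(2) by simp
  qed
  ultimately show "outputs_within (sat_via_ising p) (encode_cnf n F) (7000 * real U ^ 3 + T m (n + 5))
    (\<lambda>out. out 0 \<noteq> 0 \<longleftrightarrow> satisfiable F)"
    unfolding outputs_within_def achieves_def sat[symmetric] by (smt (verit, best) of_nat_mono)
qed

text \<open>Clauses of length at most \<open>k\<close> keep the number of tokens linear in the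
  number of clauses, so the graph has polynomial size for fixed \<open>k\<close>.\<close>

lemma length_tokens_le:
  assumes "is_kcnf k n F"
  shows "length (tokens F) + 2 \<le> (k + 3) * (1 + length F)"
  using assms by (induction F) (auto simp: tokens_simps clause_codes_def is_kcnf_def)

text \<open>A running time has to be positive on both a graph of cutwidth 0 and one of cutwidth 1.\<close>

lemma base_positive:
  assumes p: "computes_tutte_curve_within 2 p (\<lambda>n w. C * b ^ w * real n ^ d)"
  shows "0 < C" and "0 < b"
proof -
  have pos: "0 < C * b ^ cutwidth (graph_of n es) * real n ^ d" if inst: "is_instance n es vs" for n es vs
  proof -
    obtain t s where "exec p (init_memory (encode_instance n es vs)) t s"
      "real t \<le> C * b ^ cutwidth (graph_of n es) * real n ^ d"
      using p[unfolded computes_tutte_curve_within_def, rule_format, OF inst]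
      unfolding outputs_within_def by auto
    moreover from this(1) have "0 < t" by (induction rule: exec.induct) auto
    ultimately show ?thesis by linarith
  qed
  have "order_width (graph_of 1 []) vs = 0" for vs
    unfolding order_width_def cut_edges_def graph_of_def by simp
  moreover have perm1: "permutations_of_set {..<1 :: nat} = {[0]}"
    by (simp add: lessThan_Suc permutations_of_set_singleton)
  ultimately have w0: "cutwidth (graph_of 1 []) = 0" "is_instance 1 [] [0]"
    by (auto simp: cutwidth_def graph_of_def is_instance_def)
  from pos[OF w0(2)] w0(1) show C: "0 < C" by simp
  let ?G = "graph_of 2 [(0, 1)]"
  have ce: "card (cut_edges ?G vs i) = of_bool (i = 1)" if "vs \<in> {[0, 1], [1, 0]}" for vs i
  proof -
    have "cut_edges ?G vs i = (if i = 1 then {0} else {})"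
      using that by (cases i rule: nat.exhaust; cases "i - 1") 
        (auto simp: cut_edges_def graph_of_def numeral_2_eq_2)
    then show ?thesis by simp
  qed
  have ow: "order_width ?G vs = 1" if "vs \<in> {[0, 1], [1, 0]}" for vs
  proof -
    have "{..length vs} = {0, 1, 2}" using that by auto
    then show ?thesis unfolding order_width_def using ce[OF that] by simp
  qed
  have perm: "permutations_of_set {..<2 :: nat} = {[0, 1], [1, 0]}"
    by (simp add: numeral_2_eq_2 lessThan_Suc permutations_of_set_doubleton insert_commute)
  have "verts ?G = {..<2}" by (simp add: graph_of_def)
  then have "cutwidth ?G = 1" unfolding cutwidth_def using perm ow by simp
  moreover from this have "is_instance 2 [(0, 1)] [0, 1]"
    using ow perm by (simp add: is_instance_def)
  ultimately have "0 < C * b * 2 ^ d" using pos[of 2 "[(0, 1)]" "[0, 1]"] by simp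
  then show "0 < b" using C by (simp add: zero_less_mult_iff)
qed

theorem theorem36:
  fixes \<epsilon> :: real
  assumes "\<epsilon> > 0" and SETH
  shows "\<not> (\<exists>(p :: com) (C :: real) (d :: nat).
            computes_tutte_curve_within 2 p (\<lambda>n w. C * (2 - \<epsilon>) ^ w * real n ^ d))"
proof
  assume "\<exists>(p :: com) (C :: real) (d :: nat).
            computes_tutte_curve_within 2 p (\<lambda>n w. C * (2 - \<epsilon>) ^ w * real n ^ d)"
  then obtain p C d where p: "computes_tutte_curve_within 2 p (\<lambda>n w. C * (2 - \<epsilon>) ^ w * real n ^ d)"
    by blast
  \<comment> \<open>Positivity of the base rules out \<epsilon> \<ge> 2, where powers of
    \<open>2 - \<epsilon>\<close> could vanish or alternate in sign.\<close>
  note C = base_positive(1)[OF p] and b = base_positive(2)[OF p]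
  \<comment> \<open>Capping at 1 keeps \<open>2 - \<delta>\<close> at least 1, so that its powers
    can also absorb the purely polynomial cost of the reduction.\<close>
  define \<delta> where "\<delta> = min \<epsilon> 1"
  have "\<delta> > 0" using assms(1) by (simp add: \<delta>_def)
  then obtain k where k: "\<not> (\<exists>p C d. solves_kSAT_within k p (\<lambda>n m. C * (2 - \<delta>) ^ n * real (1 + n + m) ^ d))"
    using assms(2) unfolding SETH_def by blast
  \<comment> \<open>The exponent 5 is the additive excess of the cutwidth over the number of
    variables. In \<open>K\<close>, the factor \<open>20 * (k + 3)\<close> comes from bounding the
    instance size by \<open>20 * (k + 3) * (1 + n + m)^2\<close>; the square explains the doubled
    exponent of the final polynomial.\<close>
  define D where "D = C * (2 - \<epsilon>) ^ 5"
  define K where "K = (7000 + D) * real (20 * (k + 3)) ^ (d + 3)"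
  have D: "0 < D" using C b by (simp add: D_def)
  have "solves_kSAT_within k (sat_via_ising p) (\<lambda>n m. K * (2 - \<delta>) ^ n * real (1 + n + m) ^ (2 * (d + 3)))"
    unfolding solves_kSAT_within_def
  proof (intro allI impI)
    fix n F assume F: "is_kcnf k n F"
    let ?U = "(length (tokens F) + 2) * (6 * n + 20)" and ?m = "ising_order n (tokens F)"
    let ?L = "1 + n + length F"
    note out = sat_via_ising_correct[OF p F]
    have "?U \<le> ((k + 3) * ?L) * (20 * ?L)"
    proof (rule mult_le_mono)
      have "length (tokens F) + 2 \<le> (k + 3) * (1 + length F)" using F by (rule length_tokens_le)
      also have "\<dots> \<le> (k + 3) * ?L" by (intro mult_le_mono2) simp
      finally show "length (tokens F) + 2 \<le> (k + 3) * ?L" .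
    qed simp
    also have "\<dots> = 20 * (k + 3) * ?L ^ 2" by (simp only: power2_eq_square mult_ac)
    finally have U: "?U \<le> 20 * (k + 3) * ?L ^ 2" .
    have two: "1 \<le> (2 - \<delta>) ^ n" "(2 - \<epsilon>) ^ n \<le> (2 - \<delta>) ^ n"
      using b by (auto simp: \<delta>_def intro: one_le_power power_mono)
    have U1: "1 \<le> real ?U" by (simp add: algebra_simps)
    have "7000 * real ?U ^ 3 + C * (2 - \<epsilon>) ^ (n + 5) * real ?m ^ d =
        7000 * (1 * real ?U ^ 3) + D * ((2 - \<epsilon>) ^ n * real ?m ^ d)"
      by (simp add: D_def power_add mult_ac)
    also have "\<dots> \<le> 7000 * ((2 - \<delta>) ^ n * real ?U ^ (d + 3)) + D * ((2 - \<delta>) ^ n * real ?U ^ (d + 3))"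
    proof (intro add_mono mult_left_mono mult_mono)
      show "real ?U ^ 3 \<le> real ?U ^ (d + 3)" using U1 by (intro power_increasing) auto
      have "real ?m ^ d \<le> real ?U ^ d" using out(1) by (intro power_mono) (simp_all only: of_nat_le_iff of_nat_0_le_iff)
      also have "\<dots> \<le> real ?U ^ (d + 3)" using U1 by (intro power_increasing) auto
      finally show "real ?m ^ d \<le> real ?U ^ (d + 3)" .
    qed (use two b D in auto)
    also have "\<dots> = (7000 + D) * (2 - \<delta>) ^ n * real ?U ^ (d + 3)" by (simp add: algebra_simps)
    also have "\<dots> \<le> (7000 + D) * (2 - \<delta>) ^ n * real (20 * (k + 3) * ?L ^ 2) ^ (d + 3)"
    proof (intro mult_left_mono power_mono)
      show "real ?U \<le> real (20 * (k + 3) * ?L ^ 2)" using U by (simp only: of_nat_le_iff)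
    qed (use two D in auto)
    also have "\<dots> = K * (2 - \<delta>) ^ n * real ?L ^ (2 * (d + 3))"
      unfolding K_def of_nat_mult of_nat_power power_mult_distrib power_mult by (simp only: mult_ac)
    finally have le: "7000 * real ?U ^ 3 + C * (2 - \<epsilon>) ^ (n + 5) * real ?m ^ d \<le>
        K * (2 - \<delta>) ^ n * real ?L ^ (2 * (d + 3))" .
    show "outputs_within (sat_via_ising p) (encode_cnf n F)
        (K * (2 - \<delta>) ^ n * real ?L ^ (2 * (d + 3))) (\<lambda>out. (out 0 \<noteq> 0) = satisfiable F)"
      using out(2) le unfolding outputs_within_def by (meson order_trans)
  qed
  then show False using k by blast
qed

end
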